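(* Let $G$ be a locally compact, $\sigma$-compact abelian group, let $(X,G,m)$ be a dynamical system and let $(Y,G,\Phi(m))$ be a TMDS factor of $(X,G,m)$ with factor map $\Phi:X\to Y$. Let $\widehat\gamma$ be the diffraction of $(Y,G,\Phi(m))$. Then $$|\check\varphi|^2\,\widehat\gamma=\varrho^{\mathcal{N}_\varphi\circ\Phi}$$ for all $\varphi\in C_c(G)$.
   Context: $G$ is written additively, with Haar measure $m_G$ and dual group $\widehat{G}$. A dynamical system $(X,G,m)$ consists of a compact (Hausdorff) space $X$ with a continuous action $(t,x)\mapsto\alpha_t(x)$ of $G$ and a $G$-invariant (Radon) probability measure $m$ on $X$. $\langle f,g\rangle=\int_X f\overline g\,dm$ and $T_tf=f\circ\alpha_{-t}$. The spectral measure of $f\in L^2(X,m)$ is the unique finite measure $\varrho^f$ on $\widehat{G}$ with $\langle T_tf,f\rangle=\int_{\widehat{G}}\eta(t)\,d\varrho^f(\eta)$ for all $t\in G$. A dynamical system $(Y,G,n)$ is a factor of $(X,G,m)$ if there is a continuous surjective $G$-equivariant map $\Phi:X\to Y$ (factor map) with $\Phi(m)=n$ (push-forward). A (complex Radon) measure $\mu$ on $G$ is translation bounded if $\sup_{t\in G}|\mu|(t+U)<\infty$ for one (equivalently all) nonempty relatively compact open $U\subset G$. $M^\infty(G)$ is the set of translation bounded measures with the vague topology, on which $G$ acts by $(t\mu)(\varphi)=\mu(\varphi(\cdot+t))$, $\varphi\in C_c(G)$. A dynamical system of translation bounded measures (TMDS) is a dynamical system $(Y,G,n)$ with $Y\subset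 M^\infty(G)$ compact and translation invariant and $n$ an invariant probability measure on $Y$. A TMDS factor is a factor that is a TMDS. For $\varphi,\psi\in C_c(G)$: $(\varphi\ast\psi)(t)=\int_G\varphi(t-s)\psi(s)\,dm_G(s)$, $\widetilde\varphi(t)=\overline{\varphi(-t)}$, $\check\varphi(\eta)=\int_G\eta(t)\varphi(t)\,dm_G(t)$. For a TMDS $(Y,G,n)$ and $\varphi\in C_c(G)$, $\mathcal{N}_\varphi\in C(Y)$ is $\mathcal{N}_\varphi(\mu)=\int_G\varphi\,d\mu$. The autocorrelation $\gamma$ of $(Y,G,n)$ is the unique translation bounded measure on $G$ with $\gamma(\varphi\ast\widetilde\psi)=\langle\mathcal{N}_\varphi,\mathcal{N}_\psi\rangle_{L^2(Y,n)}$ for all $\varphi,\psi\in C_c(G)$. Its Fourier transform, the diffraction $\widehat\gamma$, is the unique positive measure on $\widehat{G}$ with $\gamma(\varphi\ast\widetilde\varphi)=\int_{\widehat{G}}|\check\varphi|^2\,d\widehat\gamma$ for all $\varphi\in C_c(G)$. *)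

theory Defs
  imports "HOL-Analysis.Analysis"
begin

definition borel_of :: "'a topology \<Rightarrow> 'a measure" where
  "borel_of T = sigma (topspace T) {U. openin T U}"

text \<open>Positive Radon measures as Borel measures: locally finite, outer regular on Borel sets and
  inner regular on open sets. This is the convention under which they correspond bijectively to
  the positive functionals on the compactly supported continuous functions of a locally compact
  Hausdorff space, also when that space is not \<open>\<sigma>\<close>-compact.\<close>

definition radon_measure :: "'a topology \<Rightarrow> 'a measure \<Rightarrow> bool" where
  "radon_measure T M \<longleftrightarrow>
     sets M = sets (borel_of T) \<and>
     (\<forall>K. compactin T K \<longrightarrow> emeasure M K < \<infinity>) \<and>
     (\<forall>A\<in>sets M. emeasure M A = (INF U\<in>{U. openin T U \<and> A \<subseteq> U}. emeasure M U)) \<and>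
     (\<forall>U. openin T U \<longrightarrow>
        emeasure M U = (SUP K\<in>{K. compactin T K \<and> K \<subseteq> U}. emeasure M K))"

definition sigma_compact_space :: "'a topology \<Rightarrow> bool" where
  "sigma_compact_space T \<longleftrightarrow>
     (\<exists>K :: nat \<Rightarrow> 'a set. (\<forall>n. compactin T (K n)) \<and> (\<Union>n. K n) = topspace T)"

definition haar_measure :: "'g::{topological_ab_group_add,t2_space} measure \<Rightarrow> bool" where
  "haar_measure mG \<longleftrightarrow>
     radon_measure euclidean mG \<and> emeasure mG (space mG) \<noteq> 0 \<and>
     (\<forall>t. distr mG mG (\<lambda>s. t + s) = mG)"

definition supp :: "('g::topological_space \<Rightarrow> complex) \<Rightarrow> 'g set" where
  "supp \<phi> = closure {t. \<phi> t \<noteq> 0}"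

definition Cc :: "('g::topological_space \<Rightarrow> complex) set" where
  "Cc = {\<phi>. continuous_on UNIV \<phi> \<and> compact (supp \<phi>)}"

definition convolution ::
    "'g::{topological_ab_group_add,t2_space} measure \<Rightarrow> ('g \<Rightarrow> complex) \<Rightarrow> ('g \<Rightarrow> complex) \<Rightarrow> 'g \<Rightarrow> complex" where
  "convolution mG \<phi> \<psi> t = (LINT s|mG. \<phi> (t - s) * \<psi> s)"

definition tilde :: "('g::{topological_ab_group_add,t2_space} \<Rightarrow> complex) \<Rightarrow> 'g \<Rightarrow> complex" where
  "tilde \<phi> t = cnj (\<phi> (- t))"

definition characters :: "('g::{topological_ab_group_add,t2_space} \<Rightarrow> complex) set" where
  "characters = {\<eta>. continuous_on UNIV \<eta> \<and> (\<forall>t. norm (\<eta> t) = 1) \<and>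
                    (\<forall>s t. \<eta> (s + t) = \<eta> s * \<eta> t)}"

text \<open>The compact-open topology. The subbasic set given by \<open>K = {}\<close> is all of \<^const>\<open>characters\<close>,
  which is therefore the underlying set.\<close>

definition dual_topology :: "('g::{topological_ab_group_add,t2_space} \<Rightarrow> complex) topology" where
  "dual_topology =
     topology_generated_by {{\<eta>\<in>characters. \<eta> ` K \<subseteq> U} |K U. compact K \<and> open U}"

definition check ::
    "'g::{topological_ab_group_add,t2_space} measure \<Rightarrow> ('g \<Rightarrow> complex) \<Rightarrow> ('g \<Rightarrow> complex) \<Rightarrow> complex" where
  "check mG \<phi> \<eta> = (LINT t|mG. \<eta> t * \<phi> t)"

text \<open>A complex Radon measure on \<open>G\<close> is a linear functional on \<open>C\<^sub>c(G)\<close>, bounded with respect to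
  the supremum norm on the functions supported in any fixed compact set; for noncompact \<open>G\<close> it need
  not be a set function on all Borel sets. The functionals are \<^const>\<open>extensional\<close> on \<^const>\<open>Cc\<close>, so that
  equality of functionals is equality of measures.\<close>

type_synonym 'g cmeasure = "('g \<Rightarrow> complex) \<Rightarrow> complex"

definition cmeasures :: "'g::{topological_ab_group_add,t2_space} cmeasure set" where
  "cmeasures = {\<mu>\<in>extensional Cc.
     (\<forall>\<phi>\<in>Cc. \<forall>\<psi>\<in>Cc. \<mu> (\<lambda>t. \<phi> t + \<psi> t) = \<mu> \<phi> + \<mu> \<psi>) \<and>
     (\<forall>\<phi>\<in>Cc. \<forall>c. \<mu> (\<lambda>t. c * \<phi> t) = c * \<mu> \<phi>) \<and>
     (\<forall>K. compact K \<longrightarrow>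
        (\<exists>C. \<forall>\<phi>\<in>Cc. supp \<phi> \<subseteq> K \<longrightarrow> norm (\<mu> \<phi>) \<le> C * (SUP t. norm (\<phi> t))))}"

text \<open>The total variation \<open>|\<mu>|\<close>, first as a functional on the nonnegative \<open>\<phi> \<in> C\<^sub>c(G)\<close>, then as a
  measure evaluated on open sets.\<close>

definition variation :: "'g::{topological_ab_group_add,t2_space} cmeasure \<Rightarrow> ('g \<Rightarrow> real) \<Rightarrow> ennreal" where
  "variation \<mu> \<phi> = (SUP \<psi>\<in>{\<psi>\<in>Cc. \<forall>t. norm (\<psi> t) \<le> \<phi> t}. ennreal (norm (\<mu> \<psi>)))"

definition variation_open :: "'g::{topological_ab_group_add,t2_space} cmeasure \<Rightarrow> 'g set \<Rightarrow> ennreal" where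
  "variation_open \<mu> U =
     (SUP \<phi>\<in>{\<phi>. (\<lambda>t. complex_of_real (\<phi> t)) \<in> Cc \<and> (\<forall>t. 0 \<le> \<phi> t \<and> \<phi> t \<le> 1) \<and>
                supp (\<lambda>t. complex_of_real (\<phi> t)) \<subseteq> U}. variation \<mu> \<phi>)"

definition translation_bounded :: "'g::{topological_ab_group_add,t2_space} cmeasure \<Rightarrow> bool" where
  "translation_bounded \<mu> \<longleftrightarrow>
     (\<exists>U. open U \<and> U \<noteq> {} \<and> compact (closure U) \<and>
          (SUP t. variation_open \<mu> ((\<lambda>s. t + s) ` U)) < \<infinity>)"

definition tb_measures :: "'g::{topological_ab_group_add,t2_space} cmeasure set" where
  "tb_measures = {\<mu>\<in>cmeasures. translation_bounded \<mu>}"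

definition vague_topology :: "'g::{topological_ab_group_add,t2_space} cmeasure topology" where
  "vague_topology = subtopology (product_topology (\<lambda>_. euclidean) Cc) tb_measures"

definition translate :: "'g::{topological_ab_group_add,t2_space} \<Rightarrow> 'g cmeasure \<Rightarrow> 'g cmeasure" where
  "translate t \<mu> = (\<lambda>\<phi>\<in>Cc. \<mu> (\<lambda>s. \<phi> (s + t)))"

definition dynamical_system ::
    "'x topology \<Rightarrow> ('g::{topological_ab_group_add,t2_space} \<Rightarrow> 'x \<Rightarrow> 'x) \<Rightarrow> 'x measure \<Rightarrow> bool" where
  "dynamical_system X \<alpha> m \<longleftrightarrow>
     compact_space X \<and> Hausdorff_space X \<and>
     (\<forall>x\<in>topspace X. \<alpha> 0 x = x) \<and>
     (\<forall>s t. \<forall>x\<in>topspace X. \<alpha> (s + t) x = \<alpha> s (\<alpha> t x)) \<and>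
     continuous_map (prod_topology euclidean X) X (\<lambda>(t, x). \<alpha> t x) \<and>
     radon_measure X m \<and> emeasure m (space m) = 1 \<and>
     (\<forall>t. distr m m (\<alpha> t) = m)"

definition factor_map ::
    "'x topology \<Rightarrow> ('g::{topological_ab_group_add,t2_space} \<Rightarrow> 'x \<Rightarrow> 'x) \<Rightarrow> 'x measure \<Rightarrow>
     'y topology \<Rightarrow> ('g \<Rightarrow> 'y \<Rightarrow> 'y) \<Rightarrow> 'y measure \<Rightarrow> ('x \<Rightarrow> 'y) \<Rightarrow> bool" where
  "factor_map X \<alpha> m Y \<beta> n \<Phi> \<longleftrightarrow>
     dynamical_system X \<alpha> m \<and> dynamical_system Y \<beta> n \<and>
     continuous_map X Y \<Phi> \<and> \<Phi> ` topspace X = topspace Y \<and>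
     (\<forall>t. \<forall>x\<in>topspace X. \<Phi> (\<alpha> t x) = \<beta> t (\<Phi> x)) \<and>
     distr m (borel_of Y) \<Phi> = n"

definition TMDS ::
    "'g::{topological_ab_group_add,t2_space} cmeasure set \<Rightarrow> 'g cmeasure measure \<Rightarrow> bool" where
  "TMDS Y n \<longleftrightarrow>
     Y \<subseteq> tb_measures \<and> compactin vague_topology Y \<and> (\<forall>t. \<forall>\<mu>\<in>Y. translate t \<mu> \<in> Y) \<and>
     dynamical_system (subtopology vague_topology Y) translate n"

definition L2_inner :: "'x measure \<Rightarrow> ('x \<Rightarrow> complex) \<Rightarrow> ('x \<Rightarrow> complex) \<Rightarrow> complex" where
  "L2_inner m f g = (LINT x|m. f x * cnj (g x))"

definition koopman ::
    "('g::{topological_ab_group_add,t2_space} \<Rightarrow> 'x \<Rightarrow> 'x) \<Rightarrow> 'g \<Rightarrow> ('x \<Rightarrow> complex) \<Rightarrow> 'x \<Rightarrow> complex" where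
  "koopman \<alpha> t f = f \<circ> \<alpha> (- t)"

definition is_spectral_measure ::
    "('g::{topological_ab_group_add,t2_space} \<Rightarrow> 'x \<Rightarrow> 'x) \<Rightarrow> 'x measure \<Rightarrow> ('x \<Rightarrow> complex) \<Rightarrow>
     ('g \<Rightarrow> complex) measure \<Rightarrow> bool" where
  "is_spectral_measure \<alpha> m f \<rho> \<longleftrightarrow>
     radon_measure dual_topology \<rho> \<and> finite_measure \<rho> \<and>
     (\<forall>t. L2_inner m (koopman \<alpha> t f) f = (LINT \<eta>|\<rho>. \<eta> t))"

definition spectral_measure ::
    "('g::{topological_ab_group_add,t2_space} \<Rightarrow> 'x \<Rightarrow> 'x) \<Rightarrow> 'x measure \<Rightarrow> ('x \<Rightarrow> complex) \<Rightarrow>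
     ('g \<Rightarrow> complex) measure" where
  "spectral_measure \<alpha> m f = (THE \<rho>. is_spectral_measure \<alpha> m f \<rho>)"

definition NN :: "('g::{topological_ab_group_add,t2_space} \<Rightarrow> complex) \<Rightarrow> 'g cmeasure \<Rightarrow> complex" where
  "NN \<phi> \<mu> = \<mu> \<phi>"

definition is_autocorrelation ::
    "'g::{topological_ab_group_add,t2_space} measure \<Rightarrow> 'g cmeasure measure \<Rightarrow> 'g cmeasure \<Rightarrow> bool" where
  "is_autocorrelation mG n \<gamma> \<longleftrightarrow>
     \<gamma> \<in> tb_measures \<and>
     (\<forall>\<phi>\<in>Cc. \<forall>\<psi>\<in>Cc. \<gamma> (convolution mG \<phi> (tilde \<psi>)) = L2_inner n (NN \<phi>) (NN \<psi>))"

text \<open>\<^const>\<open>has_bochner_integral\<close> includes the integrability of \<open>|check \<phi>|\<^sup>2\<close>.\<close>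

definition is_fourier_transform ::
    "'g::{topological_ab_group_add,t2_space} measure \<Rightarrow> 'g cmeasure \<Rightarrow> ('g \<Rightarrow> complex) measure \<Rightarrow> bool" where
  "is_fourier_transform mG \<gamma> \<omega> \<longleftrightarrow>
     radon_measure dual_topology \<omega> \<and>
     (\<forall>\<phi>\<in>Cc. has_bochner_integral \<omega> (\<lambda>\<eta>. complex_of_real ((norm (check mG \<phi> \<eta>))\<^sup>2))
                (\<gamma> (convolution mG \<phi> (tilde \<phi>))))"

definition is_diffraction ::
    "'g::{topological_ab_group_add,t2_space} measure \<Rightarrow> 'g cmeasure measure \<Rightarrow> ('g \<Rightarrow> complex) measure \<Rightarrow> bool" where
  "is_diffraction mG n \<omega> \<longleftrightarrow> (\<exists>\<gamma>. is_autocorrelation mG n \<gamma> \<and> is_fourier_transform mG \<gamma> \<omega>)"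

end

theory Submission
  imports Defs
begin

text \<open>Equivariance of \<open>\<Phi>\<close> and polarization of the identity defining \<open>\<gamma>hat\<close> turn
  \<open>\<langle>T\<^sub>t f, f\<rangle>\<close>, for \<open>f = NN \<phi> \<circ> \<Phi>\<close>, into the \<open>\<gamma>hat\<close>-integral of the check of the translate of \<open>\<phi>\<close>
  times the conjugate of \<open>check \<phi>\<close>. By invariance of Haar measure the former is \<open>\<eta> t * check \<phi> \<eta>\<close>, so
  the density has the correlations that define the spectral measure; it is Radon because \<open>check \<phi>\<close> is
  continuous and bounded. A finite Radon measure on the dual group is determined by the integrals of
  the characters \<open>\<eta> \<mapsto> \<eta> t\<close>: a compact set is separated from the complement of a neighbourhood by a
  trigonometric polynomial on a large compact set, which carries almost all of the mass.\<close>

section \<open>Borel and Radon measures\<close>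

lemma space_borel_of [simp]: "space (borel_of T) = topspace T"
  unfolding borel_of_def by (rule space_measure_of) (auto dest: openin_subset)

lemma sets_borel_of: "sets (borel_of T) = sigma_sets (topspace T) {U. openin T U}"
  unfolding borel_of_def by (rule sets_measure_of) (auto dest: openin_subset)

lemma openin_in_sets_borel_of: "openin T U \<Longrightarrow> U \<in> sets (borel_of T)"
  by (simp add: sets_borel_of)

lemma closedin_in_sets_borel_of:
  assumes "closedin T C"
  shows "C \<in> sets (borel_of T)"
proof -
  have "C = space (borel_of T) - (topspace T - C)"
    using closedin_subset[OF assms] by auto
  moreover have "topspace T - C \<in> sets (borel_of T)"
    using assms by (intro openin_in_sets_borel_of) (simp add: closedin_def)
  ultimately show ?thesis
    by (metis sets.compl_sets)
qed

lemma borel_of_euclidean: "borel_of euclidean = borel"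
  by (simp add: borel_of_def borel_def)

lemma measurable_borel_of_continuous_map:
  assumes "continuous_map S T f"
  shows "f \<in> borel_of S \<rightarrow>\<^sub>M borel_of T"
  unfolding borel_of_def[of T]
proof (rule measurable_measure_of)
  show "{U. openin T U} \<subseteq> Pow (topspace T)"
    by (auto dest: openin_subset)
  show "f \<in> space (borel_of S) \<rightarrow> topspace T"
    using assms by (auto simp: continuous_map_def)
  fix U
  assume "U \<in> {U. openin T U}"
  then have "openin S {x \<in> topspace S. f x \<in> U}"
    using assms openin_continuous_map_preimage by blast
  moreover have "f -` U \<inter> space (borel_of S) = {x \<in> topspace S. f x \<in> U}"
    by auto
  ultimately show "f -` U \<inter> space (borel_of S) \<in> sets (borel_of S)"
    by (simp add: openin_in_sets_borel_of)
qed

lemma borel_measurable_continuous_map: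
  assumes "continuous_map T euclidean f" "sets M = sets (borel_of T)"
  shows "f \<in> borel_measurable M"
  using measurable_borel_of_continuous_map[OF assms(1)] measurable_cong_sets[OF assms(2) refl]
  by (auto simp: borel_of_euclidean)

section \<open>Radon measures: approximation from outside and inside, comparison on compact
  sets\<close>

lemma radon_measure_sets: "radon_measure T M \<Longrightarrow> sets M = sets (borel_of T)"
  by (simp add: radon_measure_def)

lemma radon_measure_space: "radon_measure T M \<Longrightarrow> space M = topspace T"
  by (metis radon_measure_sets sets_eq_imp_space_eq space_borel_of)

lemma radon_measure_outer:
  assumes "radon_measure T M" "A \<in> sets M" "emeasure M A < \<infinity>" "0 < (e::real)"
  obtains U where "openin T U" "A \<subseteq> U" "emeasure M U < emeasure M A + ennreal e"
proof -
  have "emeasure M A < emeasure M A + ennreal e"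
    using assms(3,4)
    by (cases "emeasure M A") (auto simp: ennreal_plus[symmetric] ennreal_less_iff simp del: ennreal_plus)
  moreover have "emeasure M A = (INF U\<in>{U. openin T U \<and> A \<subseteq> U}. emeasure M U)"
    using assms(1,2) unfolding radon_measure_def by blast
  ultimately have "(INF U\<in>{U. openin T U \<and> A \<subseteq> U}. emeasure M U) < emeasure M A + ennreal e"
    by simp
  then show thesis
    using that by (auto simp: INF_less_iff)
qed

lemma radon_measure_inner:
  assumes "radon_measure T M" "openin T U" "emeasure M U < \<infinity>" "0 < (e::real)"
  obtains K where "compactin T K" "K \<subseteq> U" "emeasure M U < emeasure M K + ennreal e"
\<comment> \<open>Subtraction in \<open>ennreal\<close> truncates at zero, so a null set leaves no
  strict gap below its measure; there the empty compact set serves.\<close>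
proof (cases "emeasure M U = 0")
  case True
  then show thesis
    using that[of "{}"] assms(4) by simp
next
  case False
  then have "emeasure M U - ennreal e < emeasure M U"
    using assms by (intro ennreal_between) (auto simp: zero_less_iff_neq_zero)
  also have "emeasure M U = (SUP K\<in>{K. compactin T K \<and> K \<subseteq> U}. emeasure M K)"
    using assms by (auto simp: radon_measure_def)
  finally obtain K where K: "compactin T K" "K \<subseteq> U" "emeasure M U - ennreal e < emeasure M K"
    by (auto simp: less_SUP_iff)
  then have "emeasure M U < emeasure M K + ennreal e"
  proof (cases "emeasure M U"; cases "emeasure M K")
    fix a b
    assume "emeasure M U = ennreal a" "emeasure M K = ennreal b" "0 \<le> a" "0 \<le> b"
    moreover from this K(3) have "a - e < b"
      using \<open>0 < e\<close> by (metis ennreal_leI ennreal_minus less_imp_le not_le)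
    ultimately show ?thesis
      using \<open>0 < e\<close> by (simp add: ennreal_plus[symmetric] ennreal_less_iff del: ennreal_plus)
  qed (use assms(3) in auto)
  then show thesis
    using that K by blast
qed

text \<open>Inner regularity passes the equality from compact to open sets, outer regularity from
  open to all Borel sets.\<close>

lemma radon_measure_eqI:
  assumes M: "radon_measure T M" and N: "radon_measure T N"
    and eq: "\<And>K. compactin T K \<Longrightarrow> emeasure M K = emeasure N K"
  shows "M = N"
proof (rule measure_eqI)
  show sets: "sets M = sets N"
    using M N by (simp add: radon_measure_def)
  have op: "emeasure M U = emeasure N U" if "openin T U" for U
  proof -
    have "emeasure M U = (SUP K\<in>{K. compactin T K \<and> K \<subseteq> U}. emeasure M K)"
      using M that by (auto simp: radon_measure_def)
    also have "\<dots> = (SUP K\<in>{K. compactin T K \<and> K \<subseteq> U}. emeasure N K)"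
      using eq by (intro SUP_cong) auto
    also have "\<dots> = emeasure N U"
      using N that by (auto simp: radon_measure_def)
    finally show ?thesis .
  qed
  fix A
  assume A: "A \<in> sets M"
  have "emeasure M A = (INF U\<in>{U. openin T U \<and> A \<subseteq> U}. emeasure M U)"
    using M A by (auto simp: radon_measure_def)
  also have "\<dots> = (INF U\<in>{U. openin T U \<and> A \<subseteq> U}. emeasure N U)"
    using op by (intro INF_cong) auto
  also have "\<dots> = emeasure N A"
    using N A sets by (auto simp: radon_measure_def)
  finally show "emeasure M A = emeasure N A" .
qed

section \<open>Measures with an integrable density\<close>

lemma finite_measure_density:
  fixes h :: "'a \<Rightarrow> real"
  assumes int: "integrable M h" and nonneg: "\<And>x. x \<in> space M \<Longrightarrow> 0 \<le> h x"
  shows "finite_measure (density M (\<lambda>x. ennreal (h x)))"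
proof (rule finite_measureI)
  let ?D = "density M (\<lambda>x. ennreal (h x))"
  have "emeasure ?D (space M) = (\<integral>\<^sup>+x. ennreal (h x) \<partial>M)"
    using int by (subst emeasure_density) (auto intro!: nn_integral_cong)
  also have "\<dots> < \<infinity>"
    using int nonneg by (subst nn_integral_eq_integral) auto
  finally show "emeasure ?D (space ?D) \<noteq> \<infinity>"
    by simp
qed

text \<open>The sets where \<open>h < 1 / (i + 1)\<close> decrease to the zero set of
  \<open>h\<close>, which is null for the density. Continuity from above applies because the density
  is a finite measure, even if \<open>M\<close> is infinite on all these sets.\<close>

lemma emeasure_density_less_small:
  fixes h :: "'a \<Rightarrow> real"
  assumes int: "integrable M h" and nonneg: "\<And>x. x \<in> space M \<Longrightarrow> 0 \<le> h x" and "0 < (e::real)"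
  obtains t where "0 < t" "emeasure (density M (\<lambda>x. ennreal (h x))) {x \<in> space M. h x < t} < ennreal e"
proof -
  let ?D = "density M (\<lambda>x. ennreal (h x))"
  have [measurable]: "h \<in> borel_measurable M"
    using int by simp
  define A where "A i = {x \<in> space M. h x < 1 / real (Suc i)}" for i
  have A [measurable]: "A i \<in> sets M" for i
    unfolding A_def by measurable
  have "finite_measure ?D"
    using int nonneg by (intro finite_measure_density) auto
  then have fin: "emeasure ?D B \<noteq> \<infinity>" for B
    by (simp add: finite_measure.emeasure_finite)
  have dec: "decseq A"
  proof (rule decseq_SucI)
    fix i
    have "1 / real (Suc (Suc i)) \<le> 1 / real (Suc i)"
      by (simp add: field_simps)
    then show "A (Suc i) \<subseteq> A i"
      unfolding A_def by (auto intro: order_less_le_trans)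
  qed
  have "(\<lambda>i. emeasure ?D (A i)) \<longlonglongrightarrow> emeasure ?D (\<Inter>i. A i)"
    by (intro Lim_emeasure_decseq dec fin) auto
  moreover have "emeasure ?D (\<Inter>i. A i) = 0"
  proof -
    have h0: "h x = 0" if "x \<in> (\<Inter>i. A i)" for x
    proof (rule ccontr)
      assume "h x \<noteq> 0"
      moreover have "x \<in> A 0"
        using that by blast
      ultimately have "0 < h x"
        using nonneg[of x] by (simp add: A_def)
      then obtain i where "1 / real (Suc i) < h x"
        using reals_Archimedean unfolding inverse_eq_divide by blast
      moreover have "x \<in> A i"
        using that by blast
      ultimately show False
        by (simp add: A_def)
    qed
    have "emeasure ?D (\<Inter>i. A i) = (\<integral>\<^sup>+x. ennreal (h x) * indicator (\<Inter>i. A i) x \<partial>M)"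
      by (subst emeasure_density) auto
    also have "\<dots> = (\<integral>\<^sup>+x. 0 \<partial>M)"
      using h0 by (intro nn_integral_cong) (auto simp: indicator_def)
    finally show ?thesis
      by simp
  qed
  ultimately have "\<forall>\<^sub>F i in sequentially. emeasure ?D (A i) < ennreal e"
    using \<open>0 < e\<close> by (intro order_tendstoD(2)) auto
  then obtain i where "emeasure ?D (A i) < ennreal e"
    by (auto simp: eventually_sequentially)
  then show thesis
    using that[of "1 / real (Suc i)"] by (simp add: A_def)
qed

text \<open>\<open>M\<close> need not be \<open>\<sigma>\<close>-finite, so its regularity is only used on the sets \<open>{h \<ge> t}\<close>, \<open>t > 0\<close>, which
  have finite measure; the rest is absorbed by the small set \<open>{h < t}\<close>.\<close>

lemma radon_measure_density:
  fixes h :: "'a \<Rightarrow> real"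
  assumes T: "Hausdorff_space T" and M: "radon_measure T M"
    and h: "continuous_map T euclidean h"
    and nonneg: "\<And>x. x \<in> topspace T \<Longrightarrow> 0 \<le> h x"
    and bound: "\<And>x. x \<in> topspace T \<Longrightarrow> h x \<le> C"
    and int: "integrable M h"
  shows "radon_measure T (density M (\<lambda>x. ennreal (h x)))"
proof -
  let ?D = "density M (\<lambda>x. ennreal (h x))"
  have sets: "sets M = sets (borel_of T)" and sp [simp]: "space M = topspace T"
    using M by (simp_all add: radon_measure_sets radon_measure_space)
  have [measurable]: "h \<in> borel_measurable M"
    using int by simp
  have opM: "U \<in> sets M" if "openin T U" for U
    using that by (simp add: sets openin_in_sets_borel_of)
  have cM: "K \<in> sets M" if "compactin T K" for K
    using that compactin_imp_closedin[OF T] by (simp add: sets closedin_in_sets_borel_of)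
  have "finite_measure ?D"
    using int nonneg by (intro finite_measure_density) auto
  then have fin: "emeasure ?D B < \<infinity>" for B
    by (simp add: finite_measure.emeasure_finite less_top[symmetric])
  \<comment> \<open>The maximum with 1 makes the bound positive, so that errors can be divided by
    it.\<close>
  define C' where "C' = max C 1"
  have C': "0 < C'" "\<And>x. x \<in> topspace T \<Longrightarrow> h x \<le> C'"
    using bound by (fastforce simp: C'_def)+
  have D_le: "emeasure ?D A \<le> ennreal C' * emeasure M A" if "A \<in> sets M" for A
  proof -
    have "emeasure ?D A = (\<integral>\<^sup>+x. ennreal (h x) * indicator A x \<partial>M)"
      using that by (subst emeasure_density) auto
    also have "\<dots> \<le> (\<integral>\<^sup>+x. ennreal C' * indicator A x \<partial>M)"
      using C' by (intro nn_integral_mono mult_right_mono) (auto intro: ennreal_leI)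
    also have "\<dots> = ennreal C' * emeasure M A"
      using that by (simp add: nn_integral_cmult_indicator)
    finally show ?thesis .
  qed
  \<comment> \<open>Markov's inequality, with the finite total mass of the density on the
    right.\<close>
  have markov: "emeasure M A < \<infinity>" if "A \<in> sets M" "A \<subseteq> {x. t \<le> h x}" "0 < t" for A t
  proof -
    have "ennreal t * emeasure M A = (\<integral>\<^sup>+x. ennreal t * indicator A x \<partial>M)"
      using that by (simp add: nn_integral_cmult_indicator)
    also have "\<dots> \<le> (\<integral>\<^sup>+x. ennreal (h x) * indicator A x \<partial>M)"
      using that by (intro nn_integral_mono) (auto simp: indicator_def intro: ennreal_leI)
    also have "\<dots> = emeasure ?D A"
      using that by (subst emeasure_density) auto
    also have "\<dots> < \<infinity>"
      by (rule fin)
    finally show ?thesis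
      using \<open>0 < t\<close> by (auto simp: ennreal_mult_less_top)
  qed
  \<comment> \<open>The bound of the density by \<open>C'\<close> turns the \<open>M\<close>-error
    \<open>e / (2 * C')\<close> into \<open>e / 2\<close>; the other half of \<open>e\<close> is
    kept for the set where \<open>h\<close> is small.\<close>
  have diff_le: "emeasure ?D (B - A) \<le> ennreal (e / 2)"
    if "A \<in> sets M" "B \<in> sets M" "A \<subseteq> B" "emeasure M A < \<infinity>"
      "emeasure M B < emeasure M A + ennreal (e / (2 * C'))" for A B e
  proof -
    have "emeasure M (B - A) = emeasure M B - emeasure M A"
      using that by (intro emeasure_Diff) auto
    also have "\<dots> \<le> ennreal (e / (2 * C'))"
      using that by (intro ennreal_minus_le_iff[THEN iffD2]) (auto simp: add.commute)
    finally have "ennreal C' * emeasure M (B - A) \<le> ennreal C' * ennreal (e / (2 * C'))"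
      by (intro mult_left_mono) auto
    also have "\<dots> = ennreal (e / 2)"
      using C' by (simp add: ennreal_mult'[symmetric])
    finally show ?thesis
      using D_le[of "B - A"] that by (auto intro: order_trans)
  qed
  have outer: "emeasure ?D A = (INF U\<in>{U. openin T U \<and> A \<subseteq> U}. emeasure ?D U)"
    if A: "A \<in> sets M" for A
  proof (rule antisym)
    show "emeasure ?D A \<le> (INF U\<in>{U. openin T U \<and> A \<subseteq> U}. emeasure ?D U)"
      using opM by (intro INF_greatest emeasure_mono) auto
    show "(INF U\<in>{U. openin T U \<and> A \<subseteq> U}. emeasure ?D U) \<le> emeasure ?D A"
    proof (rule ennreal_le_epsilon)
      fix e :: real
      assume "0 < e"
      then obtain t where t: "0 < t" "emeasure ?D {x \<in> topspace T. h x < t} < ennreal (e / 2)"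
        using emeasure_density_less_small[OF int, of "e / 2"] nonneg by auto
      define S where "S = {x \<in> topspace T. h x < t}"
      have S: "openin T S"
        using openin_continuous_map_preimage[OF h, of "{..<t}"] by (simp add: S_def)
      \<comment> \<open>\<open>B\<close> has finite \<open>M\<close>-measure, hence a close open
        superset \<open>U\<close>; adding the open set \<open>S\<close> gives an open superset of
        all of \<open>A\<close>.\<close>
      define B where "B = A - S"
      have B: "B \<in> sets M"
        using A S opM by (auto simp: B_def)
      have "B \<subseteq> {x. t \<le> h x}"
        using sets.sets_into_space[OF A] by (auto simp: B_def S_def)
      then have Bfin: "emeasure M B < \<infinity>"
        using markov B t by blast
      obtain U where U: "openin T U" "B \<subseteq> U" "emeasure M U < emeasure M B + ennreal (e / (2 * C'))"
        using radon_measure_outer[OF M B Bfin, of "e / (2 * C')"] \<open>0 < e\<close> C' by auto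
      have "emeasure ?D (U \<union> S) \<le> emeasure ?D (A \<union> ((U - B) \<union> S))"
        using A B U S opM by (intro emeasure_mono) (auto simp: B_def)
      also have "\<dots> \<le> emeasure ?D A + emeasure ?D ((U - B) \<union> S)"
        using A B U S opM by (intro emeasure_subadditive) auto
      also have "\<dots> \<le> emeasure ?D A + (emeasure ?D (U - B) + emeasure ?D S)"
        using A B U S opM by (intro add_left_mono emeasure_subadditive) auto
      also have "\<dots> \<le> emeasure ?D A + (ennreal (e / 2) + ennreal (e / 2))"
        using t B U Bfin opM by (intro add_left_mono add_mono diff_le) (auto simp: S_def)
      also have "\<dots> = emeasure ?D A + ennreal e"
        using \<open>0 < e\<close> by (simp add: ennreal_plus[symmetric] del: ennreal_plus)
      finally have le: "emeasure ?D (U \<union> S) \<le> emeasure ?D A + ennreal e" .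
      have "(INF U\<in>{U. openin T U \<and> A \<subseteq> U}. emeasure ?D U) \<le> emeasure ?D (U \<union> S)"
        using U S by (intro INF_lower) (auto simp: B_def)
      then show "(INF U\<in>{U. openin T U \<and> A \<subseteq> U}. emeasure ?D U) \<le> emeasure ?D A + ennreal e"
        using le by (rule order_trans)
    qed
  qed
  have inner: "emeasure ?D V = (SUP K\<in>{K. compactin T K \<and> K \<subseteq> V}. emeasure ?D K)"
    if V: "openin T V" for V
  proof (rule antisym)
    show "(SUP K\<in>{K. compactin T K \<and> K \<subseteq> V}. emeasure ?D K) \<le> emeasure ?D V"
      using opM V by (intro SUP_least emeasure_mono) auto
    show "emeasure ?D V \<le> (SUP K\<in>{K. compactin T K \<and> K \<subseteq> V}. emeasure ?D K)"
    proof (rule ennreal_le_epsilon)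
      fix e :: real
      assume "0 < e"
      then obtain t where t: "0 < t" "emeasure ?D {x \<in> topspace T. h x < t} < ennreal (e / 2)"
        using emeasure_density_less_small[OF int, of "e / 2"] nonneg by auto
      define S where "S = {x \<in> topspace T. h x < t}"
      have S: "openin T S"
        using openin_continuous_map_preimage[OF h, of "{..<t}"] by (simp add: S_def)
      \<comment> \<open>Inner regularity is stated for open sets, and \<open>t \<le> h\<close> need
        not define one. The strict condition \<open>t / 2 < h\<close> does, still gives finite
        \<open>M\<close>-measure, and still covers \<open>V\<close> outside
        \<open>S\<close>.\<close>
      define W where "W = V \<inter> {x \<in> topspace T. t / 2 < h x}"
      have W: "openin T W"
        using openin_continuous_map_preimage[OF h, of "{t / 2<..}"] V by (auto simp: W_def)
      have "W \<subseteq> {x. t / 2 \<le> h x}"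
        by (auto simp: W_def)
      then have Wfin: "emeasure M W < \<infinity>"
        using markov[of W "t / 2"] opM W t by auto
      obtain K where K: "compactin T K" "K \<subseteq> W" "emeasure M W < emeasure M K + ennreal (e / (2 * C'))"
        using radon_measure_inner[OF M W Wfin, of "e / (2 * C')"] \<open>0 < e\<close> C' by auto
      have Kfin: "emeasure M K < \<infinity>"
        using M K by (auto simp: radon_measure_def)
      have "V \<subseteq> K \<union> ((W - K) \<union> S)"
        using openin_subset[OF V] t by (auto simp: W_def S_def)
      then have "emeasure ?D V \<le> emeasure ?D (K \<union> ((W - K) \<union> S))"
        using K W S opM cM by (intro emeasure_mono) auto
      also have "\<dots> \<le> emeasure ?D K + emeasure ?D ((W - K) \<union> S)"
        using K W S opM cM by (intro emeasure_subadditive) auto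
      also have "\<dots> \<le> emeasure ?D K + (emeasure ?D (W - K) + emeasure ?D S)"
        using K W S opM cM by (intro add_left_mono emeasure_subadditive) auto
      also have "\<dots> \<le> emeasure ?D K + (ennreal (e / 2) + ennreal (e / 2))"
        using t K W Kfin opM cM by (intro add_left_mono add_mono diff_le) (auto simp: S_def)
      also have "\<dots> = emeasure ?D K + ennreal e"
        using \<open>0 < e\<close> by (simp add: ennreal_plus[symmetric] del: ennreal_plus)
      also have "\<dots> \<le> (SUP K\<in>{K. compactin T K \<and> K \<subseteq> V}. emeasure ?D K) + ennreal e"
        using K by (intro add_right_mono SUP_upper) (auto simp: W_def)
      finally show "emeasure ?D V \<le> (SUP K\<in>{K. compactin T K \<and> K \<subseteq> V}. emeasure ?D K) + ennreal e" .
    qed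
  qed
  show ?thesis
    unfolding radon_measure_def using outer inner fin sets by simp
qed

section \<open>The dual group\<close>

lemma dual_subbasis:
  assumes "compact K" "open U"
  shows "openin dual_topology {\<eta> \<in> characters. \<eta> ` K \<subseteq> U}"
  unfolding dual_topology_def using assms by (intro topology_generated_by_Basis) blast

lemma topspace_dual [simp]: "topspace dual_topology = characters"
proof
  show "topspace dual_topology \<subseteq> characters"
    by (auto simp: dual_topology_def)
  show "characters \<subseteq> topspace dual_topology"
    using openin_subset[OF dual_subbasis[of "{}" UNIV]] by simp
qed

lemma characters_mult: "\<eta> \<in> characters \<Longrightarrow> \<eta> (s + t) = \<eta> s * \<eta> t"
  and characters_norm: "\<eta> \<in> characters \<Longrightarrow> norm (\<eta> t) = 1"
  and characters_continuous: "\<eta> \<in> characters \<Longrightarrow> continuous_on UNIV \<eta>"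
  by (auto simp: characters_def)

lemma characters_zero:
  assumes "\<eta> \<in> characters"
  shows "\<eta> 0 = 1"
proof -
  have "\<eta> 0 * \<eta> 0 = \<eta> 0"
    using characters_mult[OF assms, of 0 0] by simp
  then show ?thesis
    using characters_norm[OF assms, of 0] by auto
qed

lemma characters_minus:
  assumes "\<eta> \<in> characters"
  shows "\<eta> (- t) = cnj (\<eta> t)"
proof -
  have "\<eta> t * \<eta> (- t) = 1"
    using characters_mult[OF assms, of t "- t"] characters_zero[OF assms] by simp
  moreover have "\<eta> t * cnj (\<eta> t) = 1"
    using characters_norm[OF assms] by (simp add: complex_norm_square[symmetric])
  ultimately show ?thesis
    by (metis mult_cancel_left mult_zero_left zero_neq_one)
qed

lemma continuous_map_dual_apply: "continuous_map dual_topology euclidean (\<lambda>\<eta>. \<eta> t)"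
  unfolding continuous_map
proof (intro conjI allI impI)
  fix U :: "complex set"
  assume "openin euclidean U"
  then show "openin dual_topology {\<eta> \<in> topspace dual_topology. \<eta> t \<in> U}"
    using dual_subbasis[of "{t}" U] by simp
qed simp

lemma Hausdorff_space_dual: "Hausdorff_space dual_topology"
  unfolding Hausdorff_space_def
proof (intro allI impI)
  fix \<eta> \<theta> :: "'g::{topological_ab_group_add,t2_space} \<Rightarrow> complex"
  assume *: "\<eta> \<in> topspace dual_topology \<and> \<theta> \<in> topspace dual_topology \<and> \<eta> \<noteq> \<theta>"
  then obtain t where "\<eta> t \<noteq> \<theta> t"
    by (meson ext)
  from hausdorff[OF this] obtain U V
    where UV: "open U" "open V" "\<eta> t \<in> U" "\<theta> t \<in> V" "U \<inter> V = {}"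
    by blast
  let ?W = "\<lambda>U. {\<eta> \<in> characters. \<eta> ` {t} \<subseteq> U}"
  have "openin dual_topology (?W U)" "openin dual_topology (?W V)"
    using UV by (intro dual_subbasis; simp)+
  moreover have "\<eta> \<in> ?W U" "\<theta> \<in> ?W V"
    using UV * by auto
  moreover have "disjnt (?W U) (?W V)"
    using UV(5) by (auto simp: disjnt_def)
  ultimately show "\<exists>U V. openin dual_topology U \<and> openin dual_topology V \<and> \<eta> \<in> U \<and> \<theta> \<in> V \<and> disjnt U V"
    by blast
qed

lemma dual_uniform_nhd:
  fixes \<eta> :: "'g::{topological_ab_group_add,t2_space} \<Rightarrow> complex"
  assumes \<eta>: "\<eta> \<in> characters" and K: "compact K" and "0 < e"
  obtains V where "openin dual_topology V" "\<eta> \<in> V"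
    "\<And>\<theta> t. \<theta> \<in> V \<Longrightarrow> t \<in> K \<Longrightarrow> norm (\<theta> t - \<eta> t) < e"
proof -
  have cont: "continuous_on UNIV \<eta>"
    using \<eta> by (rule characters_continuous)
  then have "compact (\<eta> ` K)"
    using K by (meson compact_continuous_image continuous_on_subset subset_UNIV)
  then obtain Z where Z: "finite Z" "\<eta> ` K \<subseteq> (\<Union>z\<in>Z. ball z (e / 4))"
    using \<open>0 < e\<close> by (metis compact_eq_totally_bounded zero_less_divide_iff zero_less_numeral)
  \<comment> \<open>The closed ball makes the constrained part of \<open>K\<close> compact. The
    radius \<open>e / 2\<close> exceeds \<open>e / 4\<close>, so \<open>\<eta>\<close> itself
    satisfies the constraint, and it places \<open>\<theta> t\<close> and \<open>\<eta> t\<close>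
    within \<open>e / 2\<close> of the same centre.\<close>
  define W where "W z = {\<theta> \<in> characters. \<theta> ` (K \<inter> \<eta> -` cball z (e / 4)) \<subseteq> ball z (e / 2)}" for z
  have W: "openin dual_topology (W z)" for z
    unfolding W_def using K cont by (intro dual_subbasis compact_Int_closed closed_vimage) auto
  define V where "V = characters \<inter> (\<Inter>z\<in>Z. W z)"
  have "openin dual_topology V"
  proof (cases "Z = {}")
    case True
    then show ?thesis
      using openin_topspace[of dual_topology] by (simp add: V_def)
  next
    case False
    then show ?thesis
      unfolding V_def using Z W openin_topspace[of dual_topology]
      by (intro openin_Int openin_INT2) auto
  qed
  moreover have "\<eta> \<in> V"
    using \<eta> \<open>0 < e\<close> by (auto simp: V_def W_def)
  moreover have "norm (\<theta> t - \<eta> t) < e" if "\<theta> \<in> V" "t \<in> K" for \<theta> t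
  proof -
    obtain z where z: "z \<in> Z" "\<eta> t \<in> ball z (e / 4)"
      using Z \<open>t \<in> K\<close> by blast
    then have "\<theta> t \<in> ball z (e / 2)"
      using that by (fastforce simp: V_def W_def)
    moreover have "\<eta> t \<in> ball z (e / 2)"
      using z(2) \<open>0 < e\<close> by auto
    ultimately have "dist (\<theta> t) (\<eta> t) < e"
      using dist_triangle_half_r[of z "\<theta> t" e "\<eta> t"] by simp
    then show ?thesis
      by (simp add: dist_norm)
  qed
  ultimately show thesis
    using that by blast
qed

subsection \<open>Trigonometric polynomials\<close>

text \<open>A monomial is prescribed on \<open>characters\<close> only, because the identities
  behind the closure properties, such as \<open>\<eta> (s + t) = \<eta> s * \<eta> t\<close>, fail
  for arbitrary functions.\<close>

inductive trig_poly :: "(('g::{topological_ab_group_add,t2_space} \<Rightarrow> complex) \<Rightarrow> complex) \<Rightarrow> bool" where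
  monom: "(\<And>\<eta>. \<eta> \<in> characters \<Longrightarrow> f \<eta> = c * \<eta> t) \<Longrightarrow> trig_poly f"
| add: "trig_poly f \<Longrightarrow> trig_poly g \<Longrightarrow> trig_poly (\<lambda>\<eta>. f \<eta> + g \<eta>)"

lemma trig_poly_const: "trig_poly (\<lambda>_. c)"
  by (rule trig_poly.monom[of _ c 0]) (simp add: characters_zero)

lemma trig_poly_mult_monom:
  assumes "trig_poly g"
  shows "(\<And>\<eta>. \<eta> \<in> characters \<Longrightarrow> f \<eta> = c * \<eta> t) \<Longrightarrow> trig_poly (\<lambda>\<eta>. f \<eta> * g \<eta>)"
  using assms
proof (induction rule: trig_poly.induct)
  case (monom g d s)
  then show ?case
    by (intro trig_poly.monom[of _ "c * d" "t + s"]) (simp add: characters_mult)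
next
  case (add g h)
  then show ?case
    by (simp add: distrib_left trig_poly.add)
qed

lemma trig_poly_mult:
  assumes "trig_poly f" "trig_poly g"
  shows "trig_poly (\<lambda>\<eta>. f \<eta> * g \<eta>)"
  using assms
proof (induction rule: trig_poly.induct)
  case (monom f c t)
  then show ?case
    using trig_poly_mult_monom by blast
next
  case (add f h)
  then show ?case
    by (simp add: distrib_right trig_poly.add)
qed

text \<open>Conjugating a character value is evaluation at \<open>- t\<close>, so the real part of a
  monomial is half the sum of the monomials at \<open>t\<close> and at \<open>- t\<close> with
  conjugate coefficients.\<close>

lemma trig_poly_Re:
  assumes "trig_poly f"
  shows "trig_poly (\<lambda>\<eta>. of_real (Re (f \<eta>)))"
  using assms
proof (induction rule: trig_poly.induct)
  case (monom f c t)
  define g where "g \<eta> = c / 2 * \<eta> t + cnj c / 2 * \<eta> (- t)" for \<eta> :: "'a \<Rightarrow> complex"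
  have g: "trig_poly g"
    unfolding g_def[abs_def]
    by (intro trig_poly.add trig_poly.monom[of _ "c / 2" t] trig_poly.monom[of _ "cnj c / 2" "- t"] refl)
  \<comment> \<open>The real part and \<open>g\<close> agree on characters only. Their difference is
    there a monomial with coefficient zero, and adding it to \<open>g\<close> yields the real part
    as a function.\<close>
  have "trig_poly (\<lambda>\<eta>. of_real (Re (f \<eta>)) - g \<eta>)"
  proof (rule trig_poly.monom[of _ 0 0])
    fix \<eta> :: "'a \<Rightarrow> complex"
    assume \<eta>: "\<eta> \<in> characters"
    have "of_real (Re z) = (z + cnj z) / 2" for z
      by (simp add: complex_add_cnj)
    from this[of "c * \<eta> t"] have "of_real (Re (f \<eta>)) = g \<eta>"
      by (simp only: monom[OF \<eta>] g_def characters_minus[OF \<eta>] complex_cnj_mult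
          add_divide_distrib times_divide_eq_left)
    then show "of_real (Re (f \<eta>)) - g \<eta> = 0 * \<eta> 0"
      by simp
  qed
  from trig_poly.add[OF g this]
  show ?case
    by simp
next
  case (add f g)
  then show ?case
    by (simp add: trig_poly.add)
qed

lemma trig_poly_continuous_map:
  assumes "trig_poly f"
  shows "continuous_map dual_topology euclidean f"
  using assms
proof (induction rule: trig_poly.induct)
  case (monom f c t)
  have "continuous_map dual_topology euclidean (\<lambda>\<eta>. c * \<eta> t)"
    using continuous_map_compose[OF continuous_map_dual_apply[of t], of euclidean "\<lambda>z. c * z"]
    by (simp add: o_def continuous_on_mult_left)
  then show ?case
    using monom by (auto elim: continuous_map_eq)
next
  case (add f g)
  from add.IH show ?case
    by (rule continuous_map_add)
qed

lemma trig_poly_bounded: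
  assumes "trig_poly f"
  shows "\<exists>B. \<forall>\<eta>\<in>characters. norm (f \<eta>) \<le> B"
  using assms
proof (induction rule: trig_poly.induct)
  case (monom f c t)
  then show ?case
    by (intro exI[of _ "norm c"]) (simp add: norm_mult characters_norm)
next
  case (add f g)
  then obtain A B where "\<forall>\<eta>\<in>characters. norm (f \<eta>) \<le> A" "\<forall>\<eta>\<in>characters. norm (g \<eta>) \<le> B"
    by blast
  then show ?case
    by (intro exI[of _ "A + B"]) (auto intro: norm_triangle_mono)
qed

lemma trig_poly_integrable:
  assumes "finite_measure M" "sets M = sets (borel_of dual_topology)" "trig_poly f"
  shows "integrable M f"
proof -
  obtain B where "\<forall>\<eta>\<in>characters. norm (f \<eta>) \<le> B"
    using trig_poly_bounded[OF assms(3)] by blast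
  moreover have "space M = characters"
    using sets_eq_imp_space_eq[OF assms(2)] by simp
  moreover have "f \<in> borel_measurable M"
    using trig_poly_continuous_map[OF assms(3)] assms(2) by (rule borel_measurable_continuous_map)
  ultimately show ?thesis
    using assms(1) by (auto intro!: finite_measure.integrable_const_bound[of M f B])
qed

text \<open>Linearity; the additive step uses that bounded functions are integrable for finite
  measures.\<close>

lemma trig_poly_integral_eq:
  assumes M: "finite_measure M" "sets M = sets (borel_of dual_topology)"
    and N: "finite_measure N" "sets N = sets (borel_of dual_topology)"
    and eq: "\<And>t. (LINT \<eta>|M. \<eta> t) = (LINT \<eta>|N. \<eta> t)"
    and "trig_poly f"
  shows "integral\<^sup>L M f = integral\<^sup>L N f"
  using \<open>trig_poly f\<close>
proof (induction rule: trig_poly.induct)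
  case (monom f c t)
  have sp: "space M = characters" "space N = characters"
    using sets_eq_imp_space_eq[OF M(2)] sets_eq_imp_space_eq[OF N(2)] by auto
  have "integral\<^sup>L M f = (LINT \<eta>|M. c * \<eta> t)"
    using monom sp by (intro Bochner_Integration.integral_cong) auto
  also have "\<dots> = (LINT \<eta>|N. c * \<eta> t)"
    by (simp add: eq)
  also have "\<dots> = integral\<^sup>L N f"
    using monom sp by (intro Bochner_Integration.integral_cong) auto
  finally show ?case .
next
  case (add f g)
  then show ?case
    using trig_poly_integrable[OF M] trig_poly_integrable[OF N] by simp
qed

subsection \<open>Separation by real trigonometric polynomials\<close>

text \<open>The library states the Stone--Weierstrass theorem for subsets of a type of class \<^class>\<open>t2_space\<close>,
  hence this copy of \<^const>\<open>characters\<close> as a type.\<close>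

typedef (overloaded) 'g dual = "characters :: ('g::{topological_ab_group_add,t2_space} \<Rightarrow> complex) set"
  morphisms character_of Dual
  by (rule exI[of _ "\<lambda>_. 1"]) (simp add: characters_def)

instantiation dual :: ("{topological_ab_group_add,t2_space}") topological_space
begin

definition open_dual :: "'a dual set \<Rightarrow> bool" where
  "open_dual U \<longleftrightarrow> openin dual_topology (character_of ` U)"

instance
proof
  have "character_of ` (UNIV :: 'a dual set) = characters"
    using type_definition.Rep_range[OF type_definition_dual] .
  then show "open (UNIV :: 'a dual set)"
    using openin_topspace[of "dual_topology :: ('a \<Rightarrow> complex) topology"] by (simp add: open_dual_def)
  show "open (S \<inter> T)" if "open S" "open T" for S T :: "'a dual set"
    using that by (simp add: open_dual_def image_Int inj_on_def character_of_inject openin_Int)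
  show "open (\<Union> K)" if "\<forall>S\<in>K. open S" for K :: "'a dual set set"
    using that by (auto simp: open_dual_def image_Union)
qed

end

lemma character_of_image_vimage: "character_of ` (character_of -` U) = characters \<inter> U"
  using type_definition.Rep_range[OF type_definition_dual] by auto

lemma open_dual_vimage:
  assumes "openin dual_topology U"
  shows "open (character_of -` U)"
proof -
  have "U \<subseteq> characters"
    using openin_subset[OF assms] by simp
  then show ?thesis
    using assms unfolding open_dual_def character_of_image_vimage by (simp add: Int_absorb1)
qed

instance dual :: ("{topological_ab_group_add,t2_space}") t2_space
proof
  fix x y :: "'a dual"
  assume "x \<noteq> y"
  then have "character_of x \<noteq> character_of y"
    by (simp add: character_of_inject)
  then obtain U V where "openin dual_topology U" "openin dual_topology V"
      "character_of x \<in> U" "character_of y \<in> V" "disjnt U V"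
    using Hausdorff_space_dual character_of unfolding Hausdorff_space_def topspace_dual by metis
  then show "\<exists>U V. open U \<and> open V \<and> x \<in> U \<and> y \<in> V \<and> U \<inter> V = {}"
    using open_dual_vimage
    by (intro exI[of _ "character_of -` U"] exI[of _ "character_of -` V"]) (auto simp: disjnt_def)
qed

lemma continuous_on_character_of:
  assumes "continuous_map dual_topology euclidean f"
  shows "continuous_on S (\<lambda>x. f (character_of x))"
proof -
  have "open ((\<lambda>x. f (character_of x)) -` U)" if "open U" for U
  proof -
    have "openin dual_topology {\<eta> \<in> topspace dual_topology. f \<eta> \<in> U}"
      using that by (intro openin_continuous_map_preimage[OF assms]) simp
    from open_dual_vimage[OF this] show ?thesis
      by (simp add: vimage_def character_of)
  qed
  then have "continuous_on UNIV (\<lambda>x. f (character_of x))"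
    by (simp add: continuous_on_open_vimage)
  then show ?thesis
    by (rule continuous_on_subset) simp
qed

lemma compact_Dual_image:
  fixes K :: "('g::{topological_ab_group_add,t2_space} \<Rightarrow> complex) set"
  assumes "compactin dual_topology K"
  shows "compact (Dual ` K)"
proof -
  have "continuous_map dual_topology euclidean (Dual :: ('g \<Rightarrow> complex) \<Rightarrow> 'g dual)"
    unfolding continuous_map
  proof (intro conjI allI impI)
    fix U :: "'g dual set"
    assume "openin euclidean U"
    moreover have "{\<eta> \<in> topspace dual_topology. Dual \<eta> \<in> U} = character_of ` U"
    proof (intro set_eqI iffI)
      fix \<eta> :: "'g \<Rightarrow> complex"
      assume "\<eta> \<in> {\<eta> \<in> topspace dual_topology. Dual \<eta> \<in> U}"
      then show "\<eta> \<in> character_of ` U"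
        by (intro image_eqI[of _ _ "Dual \<eta>"]) (simp_all add: Dual_inverse)
    next
      fix \<eta> :: "'g \<Rightarrow> complex"
      assume "\<eta> \<in> character_of ` U"
      then show "\<eta> \<in> {\<eta> \<in> topspace dual_topology. Dual \<eta> \<in> U}"
        using character_of by (elim imageE) (simp add: character_of_inverse)
    qed
    ultimately show "openin dual_topology {\<eta> \<in> topspace dual_topology. Dual \<eta> \<in> U}"
      by (simp add: open_dual_def)
  qed simp
  from image_compactin[OF assms this] show ?thesis
    by simp
qed

text \<open>The algebra for Stone--Weierstrass. That theorem concerns real functions, whereas
  \<open>trig_poly\<close> is complex, hence the passage through \<open>of_real\<close>.\<close>

definition trig_real :: "('g::{topological_ab_group_add,t2_space} dual \<Rightarrow> real) set" where
  "trig_real = {f. \<exists>p. trig_poly p \<and> (\<forall>x. of_real (f x) = p (character_of x))}"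

lemma trig_real_const: "(\<lambda>_. c) \<in> trig_real"
  unfolding trig_real_def using trig_poly_const by blast

lemma trig_real_add:
  assumes "f \<in> trig_real" "g \<in> trig_real"
  shows "(\<lambda>x. f x + g x) \<in> trig_real"
proof -
  obtain p q where "trig_poly p" "trig_poly q"
    and pq: "\<And>x. of_real (f x) = p (character_of x)" "\<And>x. of_real (g x) = q (character_of x)"
    using assms unfolding trig_real_def by blast
  then have "trig_poly (\<lambda>\<eta>. p \<eta> + q \<eta>)"
    by (intro trig_poly.add)
  moreover have "of_real (f x + g x) = p (character_of x) + q (character_of x)" for x
    by (simp add: pq)
  ultimately show ?thesis
    unfolding trig_real_def by blast
qed

lemma trig_real_mult:
  assumes "f \<in> trig_real" "g \<in> trig_real"
  shows "(\<lambda>x. f x * g x) \<in> trig_real"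
proof -
  obtain p q where "trig_poly p" "trig_poly q"
    and pq: "\<And>x. of_real (f x) = p (character_of x)" "\<And>x. of_real (g x) = q (character_of x)"
    using assms unfolding trig_real_def by blast
  then have "trig_poly (\<lambda>\<eta>. p \<eta> * q \<eta>)"
    by (intro trig_poly_mult)
  moreover have "of_real (f x * g x) = p (character_of x) * q (character_of x)" for x
    by (simp add: pq)
  ultimately show ?thesis
    unfolding trig_real_def by blast
qed

lemma trig_real_Re: "trig_poly p \<Longrightarrow> (\<lambda>x. Re (p (character_of x))) \<in> trig_real"
  unfolding trig_real_def using trig_poly_Re by blast

lemma trig_real_continuous_on:
  assumes "f \<in> trig_real"
  shows "continuous_on S f"
proof -
  obtain p where p: "trig_poly p" "\<And>x. of_real (f x) = p (character_of x)"
    using assms unfolding trig_real_def by blast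
  have "continuous_on S (\<lambda>x. Re (p (character_of x)))"
    by (intro continuous_on_Re continuous_on_character_of trig_poly_continuous_map p)
  moreover have "Re (p (character_of x)) = f x" for x
    by (metis p(2) Re_complex_of_real)
  ultimately show ?thesis
    by simp
qed

text \<open>Distinct characters differ at some \<open>t\<close>, in the real or the imaginary part;
  the coefficient \<open>- \<i>\<close> turns the imaginary part into a real part.\<close>

lemma trig_real_separates:
  assumes "x \<noteq> y"
  shows "\<exists>f\<in>trig_real. f x \<noteq> f y"
proof -
  have "character_of x \<noteq> character_of y"
    using assms by (simp add: character_of_inject)
  then obtain t where t: "character_of x t \<noteq> character_of y t"
    by (auto simp: fun_eq_iff)
  have mem: "(\<lambda>x. Re (c * character_of x t)) \<in> trig_real" for c
    by (intro trig_real_Re trig_poly.monom[of _ c t] refl)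
  from t consider "Re (1 * character_of x t) \<noteq> Re (1 * character_of y t)"
    | "Re (- \<i> * character_of x t) \<noteq> Re (- \<i> * character_of y t)"
    by (auto simp: complex_eq_iff)
  then show ?thesis
    by cases (rule bexI[OF _ mem], assumption)+
qed

lemma trig_real_polynomial:
  fixes q :: "real \<Rightarrow> real"
  assumes "real_polynomial_function q" "f \<in> trig_real"
  shows "(\<lambda>x. q (f x)) \<in> trig_real"
  using assms(1)
proof (induction rule: real_polynomial_function.induct)
  case (linear q)
  \<comment> \<open>A linear map of the real line is multiplication by its value at 1.\<close>
  then have "q y = q 1 * y" for y
    using linear_simps(5)[OF linear, of y 1] by simp
  then have "(\<lambda>x. q (f x)) = (\<lambda>x. q 1 * f x)"
    by blast
  then show ?case
    using trig_real_mult[OF trig_real_const assms(2)] by simp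
qed (auto intro: trig_real_const trig_real_add trig_real_mult)

text \<open>A trigonometric polynomial approximating on \<open>L\<close> is uncontrolled off \<open>L\<close>; composing it with a
  polynomial close to the truncation to \<open>[0, 1]\<close> gives global bounds.\<close>

lemma trig_poly_separation:
  fixes K L C :: "('g::{topological_ab_group_add,t2_space} \<Rightarrow> complex) set"
  assumes L: "compactin dual_topology L"
    and K: "compactin dual_topology K" "K \<subseteq> L" and C: "compactin dual_topology C" "C \<subseteq> L"
    and "K \<inter> C = {}" and e: "0 < e" "e < 1"
  obtains p h where "trig_poly p" "\<And>\<eta>. \<eta> \<in> characters \<Longrightarrow> p \<eta> = of_real (h \<eta>)"
    "\<And>\<eta>. \<eta> \<in> characters \<Longrightarrow> - e \<le> h \<eta> \<and> h \<eta> \<le> 1 + e"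
    "\<And>\<eta>. \<eta> \<in> K \<Longrightarrow> 1 - 2 * e \<le> h \<eta>" "\<And>\<eta>. \<eta> \<in> C \<Longrightarrow> h \<eta> \<le> 2 * e"
proof -
  have Lc: "L \<subseteq> characters"
    using compactin_subset_topspace[OF L] by simp
  interpret function_ring_on trig_real "Dual ` L"
    using L by unfold_locales
      (auto simp: compact_Dual_image trig_real_continuous_on trig_real_add trig_real_mult
        trig_real_const trig_real_separates)
  have "Dual ` C \<inter> Dual ` K = {}"
    using assms Lc by (auto simp: Dual_inject subset_iff)
  \<comment> \<open>\<open>two\<close> is the separation lemma from the proof of Stone--Weierstrass:
    disjoint closed subsets of a compact set are separated within the algebra, with values in
    \<open>[0, 1]\<close> on that set.\<close>
  then obtain f where f: "f \<in> trig_real" "f ` Dual ` L \<subseteq> {0..1}"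
      "\<forall>x\<in>Dual ` C. f x < e" "\<forall>x\<in>Dual ` K. f x > 1 - e"
    using two[of "Dual ` C" "Dual ` K" e] K C e
    by (auto simp: compact_imp_closed compact_Dual_image image_mono)
  obtain p where p: "trig_poly p" "\<And>x. of_real (f x) = p (character_of x)"
    using f(1) unfolding trig_real_def by blast
  \<comment> \<open>The bound confines the values of \<open>f\<close> to \<open>[-B, B]\<close> off
    \<open>L\<close> as well, so it is enough that \<open>q\<close> approximates the truncation on
    this compact interval.\<close>
  obtain B where B: "\<forall>\<eta>\<in>characters. norm (p \<eta>) \<le> B"
    using trig_poly_bounded[OF p(1)] by blast
  have fB: "f x \<in> {- B..B}" for x
  proof -
    have "norm (complex_of_real (f x)) \<le> B"
      using B character_of p(2) by metis
    then show ?thesis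
      by auto
  qed
  obtain q where q: "real_polynomial_function q"
      "\<And>y. y \<in> {- B..B} \<Longrightarrow> \<bar>max 0 (min 1 y) - q y\<bar> < e"
    by (rule Stone_Weierstrass_real_polynomial_function[of "{- B..B}" "\<lambda>y. max 0 (min 1 y)" e])
      (simp_all add: e continuous_on_max continuous_on_min)
  have qf: "\<bar>max 0 (min 1 (f x)) - q (f x)\<bar> < e" for x
    using q(2) fB by blast
  obtain r where r: "trig_poly r" "\<And>x. of_real (q (f x)) = r (character_of x)"
    using trig_real_polynomial[OF q(1) f(1)] unfolding trig_real_def by blast
  define h where "h \<eta> = q (f (Dual \<eta>))" for \<eta>
  show thesis
  proof
    show "trig_poly r" by (rule r)
    show "r \<eta> = of_real (h \<eta>)" if "\<eta> \<in> characters" for \<eta>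
      using r(2)[of "Dual \<eta>"] that by (simp add: h_def Dual_inverse)
    show "- e \<le> h \<eta> \<and> h \<eta> \<le> 1 + e" for \<eta>
      using qf[of "Dual \<eta>"] unfolding h_def by linarith
    \<comment> \<open>One \<open>e\<close> is lost in the separation, the other in the approximation
      of the truncation; likewise on \<open>C\<close>.\<close>
    show "1 - 2 * e \<le> h \<eta>" if "\<eta> \<in> K" for \<eta>
    proof -
      have "f (Dual \<eta>) > 1 - e"
        using that f by blast
      then show ?thesis
        using qf[of "Dual \<eta>"] e unfolding h_def by linarith
    qed
    show "h \<eta> \<le> 2 * e" if "\<eta> \<in> C" for \<eta>
    proof -
      have "f (Dual \<eta>) < e"
        using that f by blast
      then show ?thesis
        using qf[of "Dual \<eta>"] e unfolding h_def by linarith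
    qed
  qed
qed

section \<open>Finite Radon measures on the dual group are determined by the integrals of
  evaluations\<close>

lemma compactin_dual_sets: "compactin dual_topology K \<Longrightarrow> K \<in> sets (borel_of dual_topology)"
  by (intro closedin_in_sets_borel_of compactin_imp_closedin Hausdorff_space_dual)

text \<open>Let \<open>p\<close> be nearly 1 on \<open>K\<close>, nearly 0 on \<open>L - U\<close>,
  and within \<open>e\<close> of \<open>[0, 1]\<close> everywhere. Its integrals for
  \<open>N\<close> and \<open>M\<close> agree. The first is nearly at least
  \<open>measure N K\<close>; the second nearly at most the \<open>M\<close>-mass of
  \<open>U\<close> and of the complement of \<open>L\<close>, hence nearly at most
  \<open>measure M K\<close>. Exchanging \<open>M\<close> and \<open>N\<close> gives
  equality.\<close>

lemma measure_compact_le_of_characters_eq: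
  fixes M N :: "('g::{topological_ab_group_add,t2_space} \<Rightarrow> complex) measure"
  assumes M: "radon_measure dual_topology M" "finite_measure M"
    and N: "radon_measure dual_topology N" "finite_measure N"
    and eq: "\<And>t. (LINT \<eta>|M. \<eta> t) = (LINT \<eta>|N. \<eta> t)"
    and K: "compactin dual_topology K"
  shows "measure N K \<le> measure M K"
proof (rule field_le_epsilon)
  fix d :: real
  assume "0 < d"
  interpret M: finite_measure M by fact
  interpret N: finite_measure N by fact
  have sets: "sets M = sets (borel_of dual_topology)" "sets N = sets (borel_of dual_topology)"
    using M N by (simp_all add: radon_measure_sets)
  have sp [simp]: "space M = characters" "space N = characters"
    using M N by (simp_all add: radon_measure_space)
  have op: "U \<in> sets M" if "openin dual_topology U" for U
    using that by (simp add: sets openin_in_sets_borel_of)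
  have cm: "C \<in> sets M" if "compactin dual_topology C" for C
    using that by (simp add: sets compactin_dual_sets)
  have cl: "closedin dual_topology C" if "compactin dual_topology C" for C
    using that by (intro compactin_imp_closedin Hausdorff_space_dual)
  define m n where "m = measure M characters" and "n = measure N characters"
  \<comment> \<open>\<open>c\<close> bounds the factor of \<open>e\<close> in the final estimate,
    using \<open>measure N K \<le> n\<close>, \<open>measure M K \<le> m\<close> and
    \<open>e < 1\<close>. The cap \<open>1 / 2\<close> on \<open>e\<close> ensures
    \<open>e < 1\<close>, which the separation requires.\<close>
  define c where "c = 4 * m + 3 * n + 4"
  have mn: "0 \<le> m" "0 \<le> n"
    by (simp_all add: m_def n_def)
  then have "0 < c"
    by (simp add: c_def)
  define e where "e = min (1 / 2) (d / c)"
  have e: "0 < e" "e < 1"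
    using \<open>0 < d\<close> \<open>0 < c\<close> by (auto simp: e_def)
  have ec: "e * c \<le> d"
    using \<open>0 < c\<close> by (simp add: e_def min_def field_simps)
  have fin: "emeasure M A < \<infinity>" for A
    by (simp add: M.emeasure_finite less_top[symmetric])
  obtain U where U: "openin dual_topology U" "K \<subseteq> U" "emeasure M U < emeasure M K + ennreal e"
    using radon_measure_outer[OF M(1) cm[OF K] fin e(1)] by blast
  have U_le: "measure M U \<le> measure M K + e"
    using U(3) e by (simp add: M.emeasure_eq_measure ennreal_plus[symmetric] ennreal_less_iff del: ennreal_plus)
  obtain L' where L': "compactin dual_topology L'" "emeasure M characters < emeasure M L' + ennreal e"
    using radon_measure_inner[OF M(1) openin_topspace fin e(1)] by auto
  have "m \<le> measure M L' + e"
    using L'(2) e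
    by (simp add: m_def M.emeasure_eq_measure ennreal_plus[symmetric] ennreal_less_iff del: ennreal_plus)
  \<comment> \<open>Adding \<open>K\<close> makes the separation on \<open>L\<close> applicable to
    it and only increases the captured mass.\<close>
  define L where "L = K \<union> L'"
  have L: "compactin dual_topology L"
    unfolding L_def using K L' by (intro compactin_Un)
  have "measure M L' \<le> measure M L"
    using cm[OF L] by (intro M.finite_measure_mono) (auto simp: L_def)
  with \<open>m \<le> measure M L' + e\<close> have L_le: "measure M (characters - L) \<le> e"
    using M.finite_measure_compl[OF cm[OF L]] by (simp add: m_def)
  define C where "C = L - U"
  have "closedin dual_topology C"
    unfolding C_def using cl[OF L] U by (intro closedin_diff)
  then have C: "compactin dual_topology C"
    using L by (rule closed_compactin[rotated 2]) (auto simp: C_def)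
  obtain p h where ph: "trig_poly p" "\<And>\<eta>. \<eta> \<in> characters \<Longrightarrow> p \<eta> = of_real (h \<eta>)"
    and h: "\<And>\<eta>. \<eta> \<in> characters \<Longrightarrow> - e \<le> h \<eta> \<and> h \<eta> \<le> 1 + e"
      "\<And>\<eta>. \<eta> \<in> K \<Longrightarrow> 1 - 2 * e \<le> h \<eta>" "\<And>\<eta>. \<eta> \<in> C \<Longrightarrow> h \<eta> \<le> 2 * e"
    using trig_poly_separation[OF L K _ C _ _ e] U(2) unfolding L_def C_def by blast
  have intM: "integrable M (\<lambda>\<eta>. Re (p \<eta>))" and intN: "integrable N (\<lambda>\<eta>. Re (p \<eta>))"
    using trig_poly_integrable ph(1) sets M N by blast+
  \<comment> \<open>Outside \<open>W\<close> a character lies in \<open>C\<close>, where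
    \<open>h\<close> is at most \<open>2 * e\<close>; on \<open>W\<close> only the global bound
    \<open>1 + e\<close> is available.\<close>
  define W where "W = U \<union> (characters - L)"
  have W: "W \<in> sets M"
    using op[OF U(1)] cm[OF L] sets.top[of M] by (auto simp: W_def)
  have intK: "integrable N (indicator K :: _ \<Rightarrow> real)" and intW: "integrable M (indicator W :: _ \<Rightarrow> real)"
    using cm[OF K] W sets fin
    by (auto intro!: integrable_real_indicator simp: N.emeasure_finite less_top[symmetric])
  \<comment> \<open>The integrand is a pointwise lower bound for \<open>h\<close>: off
    \<open>K\<close> it is \<open>- e\<close>, the global bound, and on \<open>K\<close> it is below
    \<open>1 - 2 * e\<close>.\<close>
  have "(1 - 2 * e) * measure N K - e * n = (LINT \<eta>|N. (1 - 2 * e) * indicator K \<eta> - e)"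
    using intK compactin_subset_topspace[OF K] by (simp add: n_def Int_absorb2)
  also have "\<dots> \<le> (LINT \<eta>|N. Re (p \<eta>))"
  proof (intro integral_mono intN)
    show "integrable N (\<lambda>\<eta>. (1 - 2 * e) * indicator K \<eta> - e)"
      using intK by simp
    fix \<eta>
    assume "\<eta> \<in> space N"
    then show "(1 - 2 * e) * indicator K \<eta> - e \<le> Re (p \<eta>)"
      using h(1,2)[of \<eta>] ph(2)[of \<eta>] e by (auto simp: indicator_def)
  qed
  also have "\<dots> = (LINT \<eta>|M. Re (p \<eta>))"
    using trig_poly_integral_eq[OF M(2) sets(1) N(2) sets(2) eq ph(1)]
      trig_poly_integrable[OF M(2) sets(1) ph(1)] trig_poly_integrable[OF N(2) sets(2) ph(1)]
    by simp
  also have "\<dots> \<le> (LINT \<eta>|M. 2 * e + (1 + e) * indicator W \<eta>)"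
  proof (intro integral_mono intM)
    show "integrable M (\<lambda>\<eta>. 2 * e + (1 + e) * indicator W \<eta>)"
      using intW by simp
    fix \<eta>
    assume "\<eta> \<in> space M"
    then show "Re (p \<eta>) \<le> 2 * e + (1 + e) * indicator W \<eta>"
      using h(1,3)[of \<eta>] ph(2)[of \<eta>] e by (auto simp: indicator_def C_def W_def)
  qed
  also have "\<dots> = 2 * e * m + (1 + e) * measure M W"
    using intW sets.sets_into_space[OF W] by (simp add: m_def Int_absorb2)
  \<comment> \<open>One \<open>e\<close> comes from the excess of \<open>U\<close> over
    \<open>K\<close>, the other from the complement of \<open>L\<close>.\<close>
  also have "\<dots> \<le> 2 * e * m + (1 + e) * (measure M K + 2 * e)"
  proof -
    have "measure M W \<le> measure M U + measure M (characters - L)"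
      unfolding W_def using op[OF U(1)] cm[OF L] sets.top[of M]
      by (intro measure_Un_le) auto
    also have "\<dots> \<le> measure M K + 2 * e"
      using U_le L_le by simp
    finally show ?thesis
      using e by (intro add_left_mono mult_left_mono) auto
  qed
  finally have *: "measure N K \<le> measure M K + e * (2 * measure N K + n + 2 * m + measure M K + 2 + 2 * e)"
    by (simp add: algebra_simps)
  have "measure N K \<le> n" "measure M K \<le> m"
    using M.bounded_measure[of K] N.bounded_measure[of K] by (simp_all add: m_def n_def)
  then have "e * (2 * measure N K + n + 2 * m + measure M K + 2 + 2 * e) \<le> e * c"
    using e mn by (intro mult_left_mono) (auto simp: c_def)
  then show "measure N K \<le> measure M K + d"
    using * ec by linarith
qed

lemma radon_measure_dual_eqI:
  fixes M N :: "('g::{topological_ab_group_add,t2_space} \<Rightarrow> complex) measure"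
  assumes "radon_measure dual_topology M" "finite_measure M"
    and "radon_measure dual_topology N" "finite_measure N"
    and "\<And>t. (LINT \<eta>|M. \<eta> t) = (LINT \<eta>|N. \<eta> t)"
  shows "M = N"
proof (rule radon_measure_eqI[OF assms(1,3)])
  fix K :: "('g \<Rightarrow> complex) set"
  assume K: "compactin dual_topology K"
  have "measure M K = measure N K"
    using measure_compact_le_of_characters_eq[OF assms K]
      measure_compact_le_of_characters_eq[OF assms(3,4,1,2) assms(5)[symmetric] K] by simp
  then show "emeasure M K = emeasure N K"
    by (simp add: finite_measure.emeasure_eq_measure assms)
qed

text \<open>Two spectral measures of \<open>f\<close> have the same integrals of evaluations, namely
  the correlations of \<open>f\<close>; so they coincide and the definite description denotes
  \<open>\<rho>\<close>.\<close>

lemma spectral_measure_eqI: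
  assumes "is_spectral_measure \<alpha> m f \<rho>"
  shows "spectral_measure \<alpha> m f = \<rho>"
  unfolding spectral_measure_def
proof (rule the_equality[where P = "is_spectral_measure \<alpha> m f", OF assms])
  fix \<sigma>
  assume "is_spectral_measure \<alpha> m f \<sigma>"
  then show "\<sigma> = \<rho>"
    using assms unfolding is_spectral_measure_def by (intro radon_measure_dual_eqI) auto
qed

section \<open>The inverse Fourier transform on compactly supported functions\<close>

lemma Cc_zero_outside: "t \<notin> supp \<phi> \<Longrightarrow> \<phi> t = 0"
  using closure_subset[of "{t. \<phi> t \<noteq> 0}"] by (auto simp: supp_def)

lemma compact_supp_subset:
  fixes \<phi> :: "'g::t2_space \<Rightarrow> complex"
  assumes "compact K" "{t. \<phi> t \<noteq> 0} \<subseteq> K"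
  shows "compact (supp \<phi>)"
proof -
  have "supp \<phi> \<subseteq> K"
    unfolding supp_def by (rule closure_minimal[OF assms(2) compact_imp_closed[OF assms(1)]])
  then have "K \<inter> supp \<phi> = supp \<phi>"
    by blast
  moreover have "compact (K \<inter> supp \<phi>)"
    using assms(1) by (rule compact_Int_closed) (simp add: supp_def)
  ultimately show ?thesis
    by simp
qed

lemma Cc_add_scaled:
  fixes \<phi> \<psi> :: "'g::t2_space \<Rightarrow> complex"
  assumes "\<phi> \<in> Cc" "\<psi> \<in> Cc"
  shows "(\<lambda>t. \<phi> t + c * \<psi> t) \<in> Cc"
proof -
  have "compact (supp \<phi> \<union> supp \<psi>)"
    using assms by (auto simp: Cc_def)
  moreover have "{t. \<phi> t + c * \<psi> t \<noteq> 0} \<subseteq> supp \<phi> \<union> supp \<psi>"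
  proof
    fix t
    assume "t \<in> {t. \<phi> t + c * \<psi> t \<noteq> 0}"
    then have "\<phi> t \<noteq> 0 \<or> \<psi> t \<noteq> 0"
      by auto
    then show "t \<in> supp \<phi> \<union> supp \<psi>"
      using Cc_zero_outside by (metis UnI1 UnI2)
  qed
  ultimately have "compact (supp (\<lambda>t. \<phi> t + c * \<psi> t))"
    by (rule compact_supp_subset)
  moreover have "continuous_on UNIV (\<lambda>t. \<phi> t + c * \<psi> t)"
    using assms by (intro continuous_on_add continuous_on_mult_left) (simp_all add: Cc_def)
  ultimately show ?thesis
    by (simp add: Cc_def)
qed

lemma Cc_scaled:
  fixes \<phi> :: "'g::t2_space \<Rightarrow> complex"
  assumes "\<phi> \<in> Cc"
  shows "(\<lambda>t. c * \<phi> t) \<in> Cc"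
  using Cc_add_scaled[of "\<lambda>_. 0" \<phi> c] assms by (simp add: Cc_def supp_def)

lemma Cc_character_mult:
  assumes "\<phi> \<in> Cc" "\<eta> \<in> characters"
  shows "(\<lambda>t. \<eta> t * \<phi> t) \<in> Cc"
proof -
  have "\<eta> t \<noteq> 0" for t
    using characters_norm[OF assms(2), of t] by auto
  then have "supp (\<lambda>t. \<eta> t * \<phi> t) = supp \<phi>"
    by (simp add: supp_def)
  moreover have "continuous_on UNIV (\<lambda>t. \<eta> t * \<phi> t)"
    using assms(1) by (intro continuous_on_mult characters_continuous[OF assms(2)]) (simp add: Cc_def)
  ultimately show ?thesis
    using assms(1) by (simp add: Cc_def)
qed

lemma Cc_translate:
  fixes \<phi> :: "'g::{topological_ab_group_add,t2_space} \<Rightarrow> complex"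
  assumes "\<phi> \<in> Cc"
  shows "(\<lambda>s. \<phi> (s + t)) \<in> Cc"
proof -
  have cont: "continuous_on UNIV (\<lambda>s. s + a)" for a :: 'g
    by (intro continuous_intros)
  have "compact ((\<lambda>s. s + - t) ` supp \<phi>)"
    using assms by (intro compact_continuous_image continuous_on_subset[OF cont subset_UNIV]) (simp add: Cc_def)
  moreover have "{s. \<phi> (s + t) \<noteq> 0} \<subseteq> (\<lambda>s. s + - t) ` supp \<phi>"
  proof
    fix s
    assume "s \<in> {s. \<phi> (s + t) \<noteq> 0}"
    then have "s + t \<in> supp \<phi>"
      using Cc_zero_outside by auto
    then show "s \<in> (\<lambda>s. s + - t) ` supp \<phi>"
      by (intro image_eqI[of _ _ "s + t"]) auto
  qed
  ultimately have "compact (supp (\<lambda>s. \<phi> (s + t)))"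
    by (rule compact_supp_subset)
  moreover have "continuous_on UNIV (\<lambda>s. \<phi> (s + t))"
    using assms continuous_on_compose2[OF _ cont] by (auto simp: Cc_def)
  ultimately show ?thesis
    by (simp add: Cc_def)
qed

text \<open>The function is bounded and vanishes off its compact support, which has finite
  measure.\<close>

lemma integrable_Cc:
  fixes \<phi> :: "'g::t2_space \<Rightarrow> complex"
  assumes mG: "radon_measure euclidean mG" and \<phi>: "\<phi> \<in> Cc"
  shows "integrable mG \<phi>"
proof -
  have sets: "sets mG = sets borel"
    using radon_measure_sets[OF mG] by (simp add: borel_of_euclidean)
  have c: "compact (supp \<phi>)" and cont: "continuous_on UNIV \<phi>"
    using \<phi> by (auto simp: Cc_def)
  have "bounded (\<phi> ` supp \<phi>)"
    using c cont by (intro compact_imp_bounded compact_continuous_image) (auto intro: continuous_on_subset)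
  then obtain B where B: "\<And>t. t \<in> supp \<phi> \<Longrightarrow> norm (\<phi> t) \<le> B"
    by (auto simp: bounded_iff)
  show ?thesis
  proof (rule integrableI_bounded_set[where A = "supp \<phi>" and B = B])
    show "supp \<phi> \<in> sets mG"
      using c by (simp add: sets borel_closed compact_imp_closed)
    show "\<phi> \<in> borel_measurable mG"
      using borel_measurable_continuous_onI[OF cont] measurable_cong_sets[OF sets refl] by blast
    show "emeasure mG (supp \<phi>) < \<infinity>"
      using mG c by (auto simp: radon_measure_def)
  qed (use B Cc_zero_outside in auto)
qed

section \<open>The transform \<open>check\<close>: linearity, translation, boundedness and
  continuity\<close>

lemma check_add_scaled:
  assumes "radon_measure euclidean mG" "\<phi> \<in> Cc" "\<psi> \<in> Cc" "\<eta> \<in> characters"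
  shows "check mG (\<lambda>t. \<phi> t + c * \<psi> t) \<eta> = check mG \<phi> \<eta> + c * check mG \<psi> \<eta>"
proof -
  have int: "integrable mG (\<lambda>t. \<eta> t * \<phi> t)" "integrable mG (\<lambda>t. \<eta> t * \<psi> t)"
    using assms by (simp_all add: integrable_Cc Cc_character_mult)
  have "check mG (\<lambda>t. \<phi> t + c * \<psi> t) \<eta> = (LINT t|mG. \<eta> t * \<phi> t + c * (\<eta> t * \<psi> t))"
    by (simp add: check_def algebra_simps)
  then show ?thesis
    using int by (simp add: check_def)
qed

text \<open>Replacing \<open>s\<close> by \<open>t + s\<close> preserves the Haar integral, and
  multiplicativity splits \<open>\<eta> t\<close> off.\<close>

lemma check_translate:
  fixes mG :: "'g::{topological_ab_group_add,t2_space} measure"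
  assumes mG: "haar_measure mG" and \<phi>: "\<phi> \<in> Cc" and \<eta>: "\<eta> \<in> characters"
  shows "check mG (\<lambda>s. \<phi> (s + - t)) \<eta> = \<eta> t * check mG \<phi> \<eta>"
proof -
  have "sets mG = sets borel"
    using mG radon_measure_sets[of euclidean mG] by (simp add: haar_measure_def borel_of_euclidean)
  have shift: "(\<lambda>s. t + s) \<in> mG \<rightarrow>\<^sub>M mG"
    using \<open>sets mG = sets borel\<close>
    by (simp add: measurable_cong_sets[of mG borel mG borel] borel_measurable_continuous_onI continuous_intros)
  have "(\<lambda>s. \<eta> s * \<phi> (s + - t)) \<in> Cc"
    by (intro Cc_character_mult Cc_translate \<phi> \<eta>)
  then have meas: "(\<lambda>s. \<eta> s * \<phi> (s + - t)) \<in> borel_measurable mG"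
    using mG by (intro borel_measurable_integrable integrable_Cc) (auto simp: haar_measure_def)
  have "check mG (\<lambda>s. \<phi> (s + - t)) \<eta> = (LINT s|distr mG mG (\<lambda>s. t + s). \<eta> s * \<phi> (s + - t))"
    using mG by (simp add: check_def haar_measure_def)
  also have "\<dots> = (LINT s|mG. \<eta> (t + s) * \<phi> (t + s + - t))"
    by (rule integral_distr[OF shift meas])
  also have "\<dots> = (LINT s|mG. \<eta> t * (\<eta> s * \<phi> s))"
    by (simp add: characters_mult[OF \<eta>] mult.assoc)
  finally show ?thesis
    by (simp add: check_def)
qed

lemma norm_check_le:
  assumes "radon_measure euclidean mG" "\<phi> \<in> Cc" "\<eta> \<in> characters"
  shows "norm (check mG \<phi> \<eta>) \<le> (LINT t|mG. norm (\<phi> t))"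
proof -
  have "norm (check mG \<phi> \<eta>) \<le> (LINT t|mG. norm (\<eta> t * \<phi> t))"
    unfolding check_def by (rule integral_norm_bound)
  then show ?thesis
    using assms by (simp add: norm_mult characters_norm)
qed

text \<open>A character uniformly within \<open>e\<close> of \<open>\<eta>\<close> on the support of
  \<open>\<phi>\<close> changes the integral by at most \<open>e\<close> times the integral of
  \<open>norm (\<phi> t)\<close>.\<close>

lemma continuous_map_check:
  fixes mG :: "'g::{topological_ab_group_add,t2_space} measure"
  assumes mG: "radon_measure euclidean mG" and \<phi>: "\<phi> \<in> Cc"
  shows "continuous_map dual_topology euclidean (check mG \<phi>)"
  unfolding continuous_map
proof (intro conjI allI impI)
  fix U :: "complex set"
  assume "openin euclidean U"
  then have "open U"
    by simp
  show "openin dual_topology {\<eta> \<in> topspace dual_topology. check mG \<phi> \<eta> \<in> U}"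
  proof (subst openin_subopen, intro ballI)
    fix \<eta>
    assume "\<eta> \<in> {\<eta> \<in> topspace dual_topology. check mG \<phi> \<eta> \<in> U}"
    then have \<eta>: "\<eta> \<in> characters" "check mG \<phi> \<eta> \<in> U"
      by auto
    then obtain r where r: "0 < r" "ball (check mG \<phi> \<eta>) r \<subseteq> U"
      using \<open>open U\<close> openE by blast
    define I where "I = (LINT t|mG. norm (\<phi> t))"
    have "0 \<le> I"
      by (simp add: I_def)
    \<comment> \<open>The added 1 keeps the quotient meaningful for \<open>I = 0\<close> and makes
      \<open>e * I < r\<close> strict.\<close>
    define e where "e = r / (I + 1)"
    have e: "0 < e" "e * I < r"
      using \<open>0 \<le> I\<close> r by (auto simp: e_def field_simps)
    obtain V where V: "openin dual_topology V" "\<eta> \<in> V"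
        "\<And>\<theta> t. \<theta> \<in> V \<Longrightarrow> t \<in> supp \<phi> \<Longrightarrow> norm (\<theta> t - \<eta> t) < e"
      using dual_uniform_nhd[OF \<eta>(1) _ e(1), of "supp \<phi>"] \<phi> by (auto simp: Cc_def)
    have VU: "check mG \<phi> \<theta> \<in> U" if "\<theta> \<in> V" for \<theta>
    proof -
      have \<theta>: "\<theta> \<in> characters"
        using that openin_subset[OF V(1)] by auto
      have int: "integrable mG (\<lambda>t. \<eta> t * \<phi> t)" "integrable mG (\<lambda>t. \<theta> t * \<phi> t)"
        using mG \<phi> \<eta> \<theta> by (simp_all add: integrable_Cc Cc_character_mult)
      have "check mG \<phi> \<theta> - check mG \<phi> \<eta> = (LINT t|mG. \<theta> t * \<phi> t - \<eta> t * \<phi> t)"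
        using int by (simp add: check_def)
      also have "norm \<dots> \<le> (LINT t|mG. norm (\<theta> t * \<phi> t - \<eta> t * \<phi> t))"
        by (rule integral_norm_bound)
      also have "\<dots> \<le> (LINT t|mG. e * norm (\<phi> t))"
      proof (rule integral_mono)
        show "integrable mG (\<lambda>t. norm (\<theta> t * \<phi> t - \<eta> t * \<phi> t))"
          using int by simp
        show "integrable mG (\<lambda>t. e * norm (\<phi> t))"
          using integrable_Cc[OF mG \<phi>] by simp
        show "norm (\<theta> t * \<phi> t - \<eta> t * \<phi> t) \<le> e * norm (\<phi> t)" for t
        proof (cases "t \<in> supp \<phi>")
          case True
          have "norm (\<theta> t * \<phi> t - \<eta> t * \<phi> t) = norm (\<theta> t - \<eta> t) * norm (\<phi> t)"
            by (simp add: norm_mult[symmetric] left_diff_distrib)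
          then show ?thesis
            using V(3)[OF \<open>\<theta> \<in> V\<close> True] by (simp add: mult_right_mono)
        qed (simp add: Cc_zero_outside)
      qed
      also have "\<dots> < r"
        using e by (simp add: I_def)
      finally show ?thesis
        using r(2) by (auto simp: dist_norm norm_minus_commute)
    qed
    show "\<exists>T. openin dual_topology T \<and> \<eta> \<in> T \<and> T \<subseteq> {\<eta> \<in> topspace dual_topology. check mG \<phi> \<eta> \<in> U}"
      using V VU openin_subset[OF V(1)] by (intro exI[of _ V]) auto
  qed
qed simp

section \<open>Diffraction and spectral measures\<close>

text \<open>The squares determine the product by the polarization identity, together with its
  integrability. \<open>Q\<close> is a free function so that two measures with the same
  \<open>Q\<close> yield the same value.\<close>

lemma has_bochner_integral_polarization:
  fixes f g :: "'a \<Rightarrow> complex"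
  assumes "\<And>c. has_bochner_integral M (\<lambda>x. complex_of_real ((norm (f x + c * g x))\<^sup>2)) (Q c)"
  shows "has_bochner_integral M (\<lambda>x. f x * cnj (g x)) ((Q 1 - Q (- 1) + \<i> * Q \<i> - \<i> * Q (- \<i>)) / 4)"
proof -
  \<comment> \<open>The factors \<open>1 *\<close> and \<open>- 1 *\<close> keep all four squares
    instances of \<open>f x + c * g x\<close>.\<close>
  have pol: "a * cnj b = (complex_of_real ((norm (a + 1 * b))\<^sup>2) - complex_of_real ((norm (a + - 1 * b))\<^sup>2)
      + \<i> * complex_of_real ((norm (a + \<i> * b))\<^sup>2) - \<i> * complex_of_real ((norm (a + - \<i> * b))\<^sup>2)) / 4"
    for a b :: complex
    unfolding cmod_power2 by (simp add: complex_eq_iff power2_eq_square algebra_simps)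
  show ?thesis
    unfolding pol[of "f _" "g _"]
    by (intro has_bochner_integral_divide_zero has_bochner_integral_diff has_bochner_integral_add
        has_bochner_integral_mult_right assms)
qed

section \<open>Evaluation functions on the hull and their correlations\<close>

lemma continuous_map_NN:
  assumes "\<phi> \<in> Cc"
  shows "continuous_map (subtopology vague_topology Y) euclidean (NN \<phi>)"
proof -
  have "continuous_map (product_topology (\<lambda>_. euclidean) Cc) euclidean (\<lambda>\<mu>. \<mu> \<phi>)"
    by (rule continuous_map_product_projection[OF assms])
  then show ?thesis
    unfolding vague_topology_def NN_def[abs_def] by (intro continuous_map_from_subtopology)
qed

lemma TMDS_NN_bounded:
  assumes Y: "TMDS Y n" and \<phi>: "\<phi> \<in> Cc"
  shows "\<exists>B. \<forall>\<mu>\<in>space n. norm (NN \<phi> \<mu>) \<le> B"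
proof -
  have rad: "radon_measure (subtopology vague_topology Y) n"
    and "compact_space (subtopology vague_topology Y)"
    using Y by (auto simp: TMDS_def dynamical_system_def)
  then have "compactin euclidean (NN \<phi> ` topspace (subtopology vague_topology Y))"
    using image_compactin[OF _ continuous_map_NN[OF \<phi>]] by (simp add: compact_space_def)
  then have "bounded (NN \<phi> ` space n)"
    by (simp only: radon_measure_space[OF rad] compactin_euclidean_iff compact_imp_bounded)
  then show ?thesis
    by (auto simp: bounded_iff)
qed

lemma TMDS_NN_integrable:
  assumes Y: "TMDS Y n" and \<phi>: "\<phi> \<in> Cc"
  shows "integrable n (\<lambda>\<mu>. complex_of_real ((norm (NN \<phi> \<mu>))\<^sup>2))"
proof -
  obtain B where B: "\<forall>\<mu>\<in>space n. norm (NN \<phi> \<mu>) \<le> B"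
    using TMDS_NN_bounded[OF Y \<phi>] by (elim exE)
  have "radon_measure (subtopology vague_topology Y) n" "emeasure n (space n) = 1"
    using Y by (auto simp: TMDS_def dynamical_system_def)
  then have "finite_measure n" and [measurable]: "NN \<phi> \<in> borel_measurable n"
    using continuous_map_NN[OF \<phi>]
    by (auto intro!: finite_measureI borel_measurable_continuous_map simp: radon_measure_sets)
  then show ?thesis
    using B by (intro finite_measure.integrable_const_bound[where B = "B\<^sup>2"] AE_I2)
      (auto intro!: power_mono simp: norm_power)
qed

text \<open>The diffraction is specified by squares alone; the sesquilinear identity is recovered by
  polarizing both sides.\<close>

lemma diffraction_polarized:
  fixes mG :: "'g::{topological_ab_group_add,t2_space} measure"
  assumes mG: "haar_measure mG" and Y: "TMDS Y n" and \<omega>: "is_diffraction mG n \<omega>"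
    and \<phi>: "\<phi> \<in> Cc" and \<psi>: "\<psi> \<in> Cc"
  shows "L2_inner n (NN \<phi>) (NN \<psi>) = (LINT \<eta>|\<omega>. check mG \<phi> \<eta> * cnj (check mG \<psi> \<eta>))"
proof -
  obtain \<gamma> where \<gamma>: "is_autocorrelation mG n \<gamma>" "is_fourier_transform mG \<gamma> \<omega>"
    using \<omega> by (auto simp: is_diffraction_def)
  have rG: "radon_measure euclidean mG"
    using mG by (simp add: haar_measure_def)
  have sp\<omega>: "space \<omega> = characters"
    using \<gamma>(2) radon_measure_space[of dual_topology \<omega>] by (simp add: is_fourier_transform_def)
  have spn: "space n \<subseteq> cmeasures"
    using Y radon_measure_space[of _ n] by (fastforce simp: TMDS_def dynamical_system_def tb_measures_def)
  define \<theta> where "\<theta> c t = \<phi> t + c * \<psi> t" for c t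
  have \<theta>: "\<theta> c \<in> Cc" for c
    unfolding \<theta>_def[abs_def] by (intro Cc_add_scaled \<phi> \<psi>)
  \<comment> \<open>\<open>Q c\<close> is both the squared norm of \<open>NN (\<theta> c)\<close> in
    the space over \<open>n\<close> and, through the autocorrelation, the integral of the squared
    modulus of \<open>check mG (\<theta> c)\<close>.\<close>
  define Q where "Q c = L2_inner n (NN (\<theta> c)) (NN (\<theta> c))" for c
  have Q\<gamma>: "Q c = \<gamma> (convolution mG (\<theta> c) (tilde (\<theta> c)))" for c
    using \<gamma>(1) \<theta> by (simp add: is_autocorrelation_def Q_def)
  have "has_bochner_integral \<omega> (\<lambda>\<eta>. complex_of_real ((norm (check mG \<phi> \<eta> + c * check mG \<psi> \<eta>))\<^sup>2)) (Q c)" for c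
  proof -
    have "has_bochner_integral \<omega> (\<lambda>\<eta>. complex_of_real ((norm (check mG (\<theta> c) \<eta>))\<^sup>2)) (Q c)"
      using \<gamma>(2) \<theta> by (simp add: is_fourier_transform_def Q\<gamma>)
    moreover have "check mG (\<theta> c) \<eta> = check mG \<phi> \<eta> + c * check mG \<psi> \<eta>" if "\<eta> \<in> space \<omega>" for \<eta>
      using check_add_scaled[OF rG \<phi> \<psi>] that by (simp add: sp\<omega> \<theta>_def[abs_def])
    ultimately show ?thesis
      by (simp cong: has_bochner_integral_cong)
  qed
  from has_bochner_integral_polarization[OF this]
  have 1: "(LINT \<eta>|\<omega>. check mG \<phi> \<eta> * cnj (check mG \<psi> \<eta>)) = (Q 1 - Q (- 1) + \<i> * Q \<i> - \<i> * Q (- \<i>)) / 4"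
    by (rule has_bochner_integral_integral_eq)
  have "has_bochner_integral n (\<lambda>\<mu>. complex_of_real ((norm (NN \<phi> \<mu> + c * NN \<psi> \<mu>))\<^sup>2)) (Q c)" for c
  proof -
    have "has_bochner_integral n (\<lambda>\<mu>. complex_of_real ((norm (NN (\<theta> c) \<mu>))\<^sup>2)) (Q c)"
      using TMDS_NN_integrable[OF Y \<theta>[of c]]
      by (simp add: has_bochner_integral_iff Q_def L2_inner_def complex_norm_square del: of_real_power)
    \<comment> \<open>The points of \<open>Y\<close> are linear functionals on \<open>Cc\<close>, so
      the combination of test functions becomes a combination of evaluations.\<close>
    moreover have "NN (\<theta> c) \<mu> = NN \<phi> \<mu> + c * NN \<psi> \<mu>" if "\<mu> \<in> space n" for \<mu>
      using that spn \<phi> \<psi> Cc_scaled[OF \<psi>, of c] unfolding NN_def \<theta>_def[abs_def] cmeasures_def by auto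
    ultimately show ?thesis
      by (simp cong: has_bochner_integral_cong)
  qed
  from has_bochner_integral_polarization[OF this]
  have "L2_inner n (NN \<phi>) (NN \<psi>) = (Q 1 - Q (- 1) + \<i> * Q \<i> - \<i> * Q (- \<i>)) / 4"
    unfolding L2_inner_def by (rule has_bochner_integral_integral_eq)
  with 1 show ?thesis
    by (simp only:)
qed

text \<open>By equivariance the Koopman operator acts on the test function:
  \<open>translate (- t)\<close> evaluates a functional at \<open>\<phi>\<close> shifted by
  \<open>- t\<close>. A change of variables along \<open>\<Phi>\<close> then replaces
  \<open>m\<close> by \<open>n\<close>.\<close>

lemma koopman_correlation_eq:
  assumes Y: "TMDS Y n" and \<Phi>: "factor_map X \<alpha> m (subtopology vague_topology Y) translate n \<Phi>"
    and \<phi>: "\<phi> \<in> Cc"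
  shows "L2_inner m (koopman \<alpha> t (NN \<phi> \<circ> \<Phi>)) (NN \<phi> \<circ> \<Phi>)
    = L2_inner n (NN (\<lambda>s. \<phi> (s + - t))) (NN \<phi>)"
proof -
  let ?T = "subtopology vague_topology Y" and ?\<psi> = "\<lambda>s. \<phi> (s + - t)"
  have \<psi>: "?\<psi> \<in> Cc"
    by (rule Cc_translate[OF \<phi>])
  have m: "radon_measure X m" and n: "n = distr m (borel_of ?T) \<Phi>"
    and equi: "\<And>t x. x \<in> topspace X \<Longrightarrow> \<Phi> (\<alpha> t x) = translate t (\<Phi> x)"
    and cont: "continuous_map X ?T \<Phi>"
    using \<Phi> by (auto simp: factor_map_def dynamical_system_def)
  have meas: "\<Phi> \<in> m \<rightarrow>\<^sub>M borel_of ?T"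
    using measurable_borel_of_continuous_map[OF cont] measurable_cong_sets[OF radon_measure_sets[OF m] refl]
    by blast
  have measNN: "NN \<theta> \<in> borel_measurable (borel_of ?T)" if "\<theta> \<in> Cc" for \<theta>
    by (rule borel_measurable_continuous_map[OF continuous_map_NN[OF that] refl])
  have "L2_inner m (koopman \<alpha> t (NN \<phi> \<circ> \<Phi>)) (NN \<phi> \<circ> \<Phi>)
      = (LINT x|m. NN ?\<psi> (\<Phi> x) * cnj (NN \<phi> (\<Phi> x)))"
    unfolding L2_inner_def
    by (intro Bochner_Integration.integral_cong refl)
      (simp add: koopman_def NN_def equi radon_measure_space[OF m] translate_def \<phi>)
  also have "\<dots> = L2_inner n (NN ?\<psi>) (NN \<phi>)"
    unfolding L2_inner_def n
    by (intro integral_distr[symmetric] meas borel_measurable_times measNN \<psi> \<phi>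
        measurable_compose[OF measNN[OF \<phi>] borel_measurable_continuous_onI[of cnj]] continuous_on_cnj
        continuous_on_id)
  finally show ?thesis .
qed

theorem proposition4p6:
  fixes mG :: "'g::{topological_ab_group_add,t2_space} measure"
    and X :: "'x topology" and \<alpha> :: "'g \<Rightarrow> 'x \<Rightarrow> 'x" and m :: "'x measure"
    and Y :: "'g cmeasure set" and \<Phi> :: "'x \<Rightarrow> 'g cmeasure"
    and n :: "'g cmeasure measure"
    and \<gamma>hat :: "('g \<Rightarrow> complex) measure"
  assumes "locally_compact_space (euclidean :: 'g topology)"
    and "sigma_compact_space (euclidean :: 'g topology)"
    and "haar_measure mG"
    and "dynamical_system X \<alpha> m"
    and "n = distr m (borel_of (subtopology vague_topology Y)) \<Phi>"
    and "TMDS Y n"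
    and "factor_map X \<alpha> m (subtopology vague_topology Y) translate n \<Phi>"
    and "is_diffraction mG n \<gamma>hat"
  shows "\<forall>\<phi>\<in>Cc. density \<gamma>hat (\<lambda>\<eta>. ennreal ((norm (check mG \<phi> \<eta>))\<^sup>2))
                  = spectral_measure \<alpha> m (NN \<phi> \<circ> \<Phi>)"
proof
  fix \<phi> :: "'g \<Rightarrow> complex"
  assume \<phi>: "\<phi> \<in> Cc"
  let ?h = "\<lambda>\<eta>. (norm (check mG \<phi> \<eta>))\<^sup>2"
  let ?\<rho> = "density \<gamma>hat (\<lambda>\<eta>. ennreal (?h \<eta>))"
  have rG: "radon_measure euclidean mG"
    using assms(3) by (simp add: haar_measure_def)
  obtain \<gamma> where \<gamma>: "is_fourier_transform mG \<gamma> \<gamma>hat"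
    using assms(8) by (auto simp: is_diffraction_def)
  then have r\<gamma>: "radon_measure dual_topology \<gamma>hat"
    by (simp add: is_fourier_transform_def)
  have "integrable \<gamma>hat (\<lambda>\<eta>. complex_of_real (?h \<eta>))"
    using \<gamma> \<phi> unfolding is_fourier_transform_def by (blast intro: integrable.intros)
  then have int: "integrable \<gamma>hat ?h"
    using integrable_Re by fastforce
  have cont: "continuous_map dual_topology euclidean (check mG \<phi>)"
    by (rule continuous_map_check[OF rG \<phi>])
  have conth: "continuous_map dual_topology euclidean ?h"
    using continuous_map_compose[OF cont, of euclidean "\<lambda>z. (norm z)\<^sup>2"]
    by (simp add: o_def continuous_intros)
  have bound: "?h \<eta> \<le> (LINT t|mG. norm (\<phi> t))\<^sup>2" if "\<eta> \<in> topspace dual_topology" for \<eta>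
    using norm_check_le[OF rG \<phi>] that by (intro power_mono) auto
  \<comment> \<open>By uniqueness it suffices that the density is Radon, finite and has the right
    integrals of evaluations.\<close>
  have "is_spectral_measure \<alpha> m (NN \<phi> \<circ> \<Phi>) ?\<rho>"
    unfolding is_spectral_measure_def
  proof (intro conjI allI)
    show "radon_measure dual_topology ?\<rho>"
      by (rule radon_measure_density[OF Hausdorff_space_dual r\<gamma> conth _ bound int]) auto
    show "finite_measure ?\<rho>"
      by (rule finite_measure_density[OF int]) simp
    fix t
    have "L2_inner m (koopman \<alpha> t (NN \<phi> \<circ> \<Phi>)) (NN \<phi> \<circ> \<Phi>)
        = (LINT \<eta>|\<gamma>hat. check mG (\<lambda>s. \<phi> (s + - t)) \<eta> * cnj (check mG \<phi> \<eta>))"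
      by (simp only: koopman_correlation_eq[OF assms(6,7) \<phi>]
          diffraction_polarized[OF assms(3,6,8) Cc_translate[OF \<phi>] \<phi>])
    \<comment> \<open>The factor \<open>\<eta> t\<close> comes from translating
      \<open>\<phi>\<close>, and the remaining product with the conjugate is \<open>?h\<close>.
      Writing it as a real scalar matches integration against a density.\<close>
    also have "\<dots> = (LINT \<eta>|\<gamma>hat. ?h \<eta> *\<^sub>R \<eta> t)"
      using check_translate[OF assms(3) \<phi>]
      by (intro Bochner_Integration.integral_cong refl)
        (simp add: radon_measure_space[OF r\<gamma>] scaleR_conv_of_real complex_norm_square mult_ac del: of_real_power)
    also have "\<dots> = (LINT \<eta>|?\<rho>. \<eta> t)"
      using int borel_measurable_continuous_map[OF continuous_map_dual_apply radon_measure_sets[OF r\<gamma>]]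
      by (subst integral_density) auto
    finally show "L2_inner m (koopman \<alpha> t (NN \<phi> \<circ> \<Phi>)) (NN \<phi> \<circ> \<Phi>) = (LINT \<eta>|?\<rho>. \<eta> t)" .
  qed
  then show "?\<rho> = spectral_measure \<alpha> m (NN \<phi> \<circ> \<Phi>)"
    by (rule spectral_measure_eqI[symmetric])
qed

end
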